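(* There is a constant $c_1>0$ such that $$\limsup_{n\to\infty}\frac1n\log P\big[\|X_n\|\le c_1 n\big]<0,$$ and consequently $$\liminf_{n\to\infty}\frac{\|X_n\|}{n}\ge c_1\qquad P\text{-a.s.}$$
   Context: Let $(X_n)_{n\ge 0}$ be the following random walk in $\mathbb{R}^2$ on a probability space $(\Omega,\mathcal F,P)$: $X_0=0$, and for $n\ge 0$, given $X_0,\dots,X_n$, the point $X_{n+1}$ is uniformly distributed on the unit circle centered at $X_n$, conditioned on the event that the straight line segment $\overline{X_n,X_{n+1}}$ does not intersect the interior $K_n^o$ of the convex hull $K_n$ of $\{X_0,X_1,\dots,X_n\}$. Here $\|\cdot\|$ is the Euclidean norm. *)

theory Defs
  imports "HOL-Probability.Probability"
begin

definition hull_upto :: "(nat \<Rightarrow> complex) \<Rightarrow> nat \<Rightarrow> complex set" where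
  "hull_upto x n = convex hull (x ` {..n})"

definition admissible :: "(nat \<Rightarrow> complex) \<Rightarrow> nat \<Rightarrow> real \<Rightarrow> bool" where
  "admissible x n \<theta> \<longleftrightarrow>
     closed_segment (x n) (x n + cis \<theta>) \<inter> interior (hull_upto x n) = {}"

definition admissible_angles :: "(nat \<Rightarrow> complex) \<Rightarrow> nat \<Rightarrow> real set" where
  "admissible_angles x n = {\<theta> \<in> {0..<2*pi}. admissible x n \<theta>}"

text \<open>Transition probability: uniform distribution on the unit circle around x n, conditioned
  on admissibility; evaluated on a Borel set B.\<close>
definition step_prob :: "(nat \<Rightarrow> complex) \<Rightarrow> nat \<Rightarrow> complex set \<Rightarrow> real" where
  "step_prob x n B =
     measure lborel {\<theta> \<in> admissible_angles x n. x n + cis \<theta> \<in> B}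
       / measure lborel (admissible_angles x n)"

definition ln_ext :: "real \<Rightarrow> ereal" where
  "ln_ext p = (if p > 0 then ereal (ln p) else -\<infinity>)"

text \<open>The process X on the probability space M is the random walk described in the paper:
  X 0 = 0, and the conditional law of X (n+1) given X 0, ..., X n is step_prob.\<close>
definition is_hull_avoiding_walk :: "'a measure \<Rightarrow> (nat \<Rightarrow> 'a \<Rightarrow> complex) \<Rightarrow> bool" where
  "is_hull_avoiding_walk M X \<longleftrightarrow>
     prob_space M \<and>
     (\<forall>n. X n \<in> borel_measurable M) \<and>
     (\<forall>\<omega>\<in>space M. X 0 \<omega> = 0) \<and>
     (\<forall>n B H. B \<in> sets borel \<longrightarrow> H \<in> sets (PiM {..n} (\<lambda>_. borel)) \<longrightarrow>
        emeasure M {\<omega> \<in> space M. (\<lambda>k\<in>{..n}. X k \<omega>) \<in> H \<and> X (Suc n) \<omega> \<in> B}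
        = (\<integral>\<^sup>+ \<omega>. indicator {\<omega> \<in> space M. (\<lambda>k\<in>{..n}. X k \<omega>) \<in> H} \<omega>
                    * ennreal (step_prob (\<lambda>k. X k \<omega>) n B) \<partial>M))"

end

(*
  At a boundary point x of the hull the admissible directions contain a half plane, and for every past
  point p the distance |x - p| is a submartingale, because reflecting in the line orthogonal to x - p maps
  the inadmissible outward directions to inadmissible inward ones.

  As potential we take the sum over a fine grid of m directions e of the discounted support functions
  G_n(e) = max over s <= n of (e . X_s - delta (n - s)). It increases on average by a fixed amount at each
  time at which some e near an outer normal v at X_n satisfies e . X_n >= G_n(e) - 1/4. If this fails, then
  on both sides of the line spanned by v there are past points in directions almost orthogonal to v and at
  distance at least L + kappa (time since the visit), where kappa is a fixed constant and L grows with m.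
  Between the later of the two visits and time n, the distance to the earlier of the two points
  (or to the farthest past point in its direction) has dropped linearly, which is exponentially unlikely
  for a submartingale with bounded increments. A weighted sum of exponential supermartingales turns this
  into an exponential bound for the number of such times. So the potential, and hence max |X_s|, grows
  linearly; that |X_n| is then small is one more linear drop of a submartingale.
*)
theory Submission
  imports Defs
begin

section \<open>Supporting directions and measurability of the hull\<close>

text \<open>The submartingale estimate concerns a fixed past point, whereas a direction may be
  blocked by any of the earlier ones. For a recent visit the forced drop is only of order L, so a
  factor n from a union bound could not be absorbed. Hence every time starts exponential
  supermartingales for at most m points selected from the path so far, and their sum psi satisfies E
  psi' <= q psi + m. The constants must survive the choice of m. With discount \<delta> = 1/(192 m)
  all grid directions together lose at most 1/192 per step, against an expected gain of 1/48 in one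
  good direction. A point blocking a direction tilted by at most 2 pi/m lies at a distance of at
  least m/(2 pi) times its discount, so kappa is proportional to \<delta> m and does not depend on
  m. Therefore \<mu> and q are fixed before m. The value of psi at a bad time is then exponentially
  large in m, while its input per step is only m; taking m large last makes bad times rare.\<close>

lemma not_interior_supporting_direction:
  fixes z :: "'a::euclidean_space"
  assumes "convex K" "z \<notin> interior K"
  obtains v where "norm v = 1" "\<And>y. y \<in> K \<Longrightarrow> v \<bullet> y \<le> v \<bullet> z"
proof -
  have "\<exists>a. a \<noteq> 0 \<and> (\<forall>y\<in>K. a \<bullet> y \<le> a \<bullet> z)"
  \<comment> \<open>A degenerate hull, such as a point or a segment, lies in a hyperplane, and its
    normal is given the sign that puts \<open>z\<close> on the outer side.\<close>
  proof (cases "interior K = {}")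
    case True
    then obtain a b where a: "a \<noteq> 0" "K \<subseteq> {x. a \<bullet> x = b}"
      using empty_interior_subset_hyperplane[OF assms(1)] by metis
    show ?thesis
    proof (cases "b \<le> a \<bullet> z")
      case True
      then show ?thesis using a by (intro exI[of _ a]) auto
    next
      case False
      then show ?thesis using a by (intro exI[of _ "-a"]) auto
    qed
  next
    case False
    obtain a b where a: "a \<noteq> 0" "\<forall>x\<in>interior K. a \<bullet> x \<le> b" "\<forall>x\<in>{z}. a \<bullet> x \<ge> b"
      using separating_hyperplane_sets[of "interior K" "{z}"] assms False
      by (auto simp: convex_interior)
    have "K \<subseteq> closure (interior K)"
      using convex_closure_interior[OF assms(1) False] closure_subset by blast
    moreover have "closure (interior K) \<subseteq> {x. a \<bullet> x \<le> b}"
      using a(2) by (intro closure_minimal closed_halfspace_le) auto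
    ultimately show ?thesis using a by (intro exI[of _ a]) force
  qed
  then obtain a where a: "a \<noteq> 0" "\<forall>y\<in>K. a \<bullet> y \<le> a \<bullet> z" by blast
  show thesis
  proof (rule that[of "a /\<^sub>R norm a"])
    show "norm (a /\<^sub>R norm a) = 1" using a by simp
    fix y assume "y \<in> K"
    then show "(a /\<^sub>R norm a) \<bullet> y \<le> (a /\<^sub>R norm a) \<bullet> z"
      using a by (simp add: divide_right_mono mult_left_mono)
  qed
qed

lemma norm_eq_1_cis:
  assumes "norm v = 1"
  obtains t where "v = cis t"
proof -
  have "v \<noteq> 0" using assms by auto
  then have "v = cis (Arg v)" using cis_Arg[of v] assms by (simp add: sgn_div_norm)
  then show thesis by (rule that)
qed

lemma norm_cis_diff_le: "norm (cis a - cis b) \<le> \<bar>a - b\<bar>"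
proof -
  have "cis a - cis b = cis b * (cis (a - b) - 1)" by (simp add: algebra_simps cis_mult)
  then have "norm (cis a - cis b) = norm (cis (a - b) - 1)" by (simp add: norm_mult)
  also have "\<dots> = 2 * \<bar>sin ((a - b) / 2)\<bar>"
    using dist_exp_i_1[of "a - b"] by (simp add: cis_conv_exp)
  also have "\<dots> \<le> \<bar>a - b\<bar>"
    using abs_sin_x_le_abs_x[of "(a - b) / 2"] by simp
  finally show ?thesis .
qed

text \<open>The support function of the hull in a direction is the maximum over the visited points,
  and an interior point stays below it by a margin that is uniform in the direction. The uniform
  margin permits a restriction to rational angles, so that only countable quantifiers remain and
  events about the hull become measurable.\<close>

lemma mem_interior_hull_upto_iff:
  "z \<in> interior (hull_upto x n) \<longleftrightarrow>
     (\<exists>m::nat. \<forall>q::rat. \<exists>s\<in>{..n}. inverse (real (Suc m)) \<le> cis (of_rat q) \<bullet> (x s - z))"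
proof
  assume "z \<in> interior (hull_upto x n)"
  then obtain d where d: "d > 0" "cball z d \<subseteq> hull_upto x n"
    by (meson mem_interior_cball)
  obtain m where m: "inverse (real (Suc m)) < d"
    using reals_Archimedean[OF d(1)] by blast
  show "\<exists>m::nat. \<forall>q::rat. \<exists>s\<in>{..n}. inverse (real (Suc m)) \<le> cis (of_rat q) \<bullet> (x s - z)"
  proof (intro exI[of _ m] allI, rule ccontr)
    fix q :: rat
    let ?e = "cis (of_rat q)"
    assume "\<not> (\<exists>s\<in>{..n}. inverse (real (Suc m)) \<le> ?e \<bullet> (x s - z))"
    then have *: "x ` {..n} \<subseteq> {y. ?e \<bullet> y < ?e \<bullet> z + inverse (real (Suc m))}"
      by (force simp: inner_diff_right not_le diff_less_eq add.commute)
    have "hull_upto x n \<subseteq> {y. ?e \<bullet> y < ?e \<bullet> z + inverse (real (Suc m))}"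
      unfolding hull_upto_def by (intro hull_minimal * convex_halfspace_lt)
    moreover have "z + d *\<^sub>R ?e \<in> hull_upto x n"
      using d by (intro subsetD[OF d(2)]) (auto simp: dist_norm)
    ultimately have "d * (?e \<bullet> ?e) < inverse (real (Suc m))"
      by (auto simp: inner_add_right)
    moreover have "?e \<bullet> ?e = 1" by (simp add: dot_square_norm)
    ultimately show False using m by simp
  qed
next
  assume "\<exists>m::nat. \<forall>q::rat. \<exists>s\<in>{..n}. inverse (real (Suc m)) \<le> cis (of_rat q) \<bullet> (x s - z)"
  then obtain m :: nat where m: "\<And>q::rat. \<exists>s\<in>{..n}. inverse (real (Suc m)) \<le> cis (of_rat q) \<bullet> (x s - z)"
    by blast
  show "z \<in> interior (hull_upto x n)"
  proof (rule ccontr)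
    assume "z \<notin> interior (hull_upto x n)"
    then obtain v where v: "norm v = 1" "\<And>y. y \<in> hull_upto x n \<Longrightarrow> v \<bullet> y \<le> v \<bullet> z"
      using not_interior_supporting_direction[of "hull_upto x n" z]
      unfolding hull_upto_def by (metis convex_convex_hull)
    obtain t where t: "v = cis t" using v(1) by (rule norm_eq_1_cis)
    define C where "C = (\<Sum>s\<le>n. norm (x s - z)) + 1"
    have C: "C > 0" "\<And>s. s \<le> n \<Longrightarrow> norm (x s - z) \<le> C"
    proof -
      show "C > 0" unfolding C_def by (intro add_nonneg_pos sum_nonneg) auto
      fix s assume "s \<le> n"
      then have "norm (x s - z) \<le> (\<Sum>s\<le>n. norm (x s - z))"
        by (intro member_le_sum) auto
      then show "norm (x s - z) \<le> C" by (simp add: C_def)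
    qed
    \<comment> \<open>Turning the direction by less than \<open>d\<close> changes every inner
      product by less than the margin, since \<open>C\<close> bounds the vectors involved; the
      summand 1 in \<open>C\<close> keeps it positive.\<close>
    define d where "d = inverse (real (Suc m)) / C"
    have d: "d > 0" "\<And>u. \<bar>u - t\<bar> < d \<Longrightarrow> norm (cis u - cis t) < inverse (real (Suc m)) / C"
      using C(1) norm_cis_diff_le[of _ t] by (auto simp: d_def intro: le_less_trans)
    obtain q :: rat where q: "t < of_rat q" "of_rat q < t + d"
      using of_rat_dense[of t "t + d"] d(1) by auto
    obtain s where s: "s \<le> n" "inverse (real (Suc m)) \<le> cis (of_rat q) \<bullet> (x s - z)"
      using m[of q] by auto
    have "cis (of_rat q) \<bullet> (x s - z) = v \<bullet> (x s - z) + (cis (of_rat q) - cis t) \<bullet> (x s - z)"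
      by (simp add: t inner_diff_left)
    also have "v \<bullet> (x s - z) \<le> 0"
      using v(2)[of "x s"] s(1) hull_inc[of "x s" "x ` {..n}"] by (auto simp: hull_upto_def inner_diff_right)
    also have "(cis (of_rat q) - cis t) \<bullet> (x s - z) \<le> norm (cis (of_rat q) - cis t) * norm (x s - z)"
      by (rule norm_cauchy_schwarz)
    also have "\<dots> \<le> norm (cis (of_rat q) - cis t) * C"
      by (intro mult_left_mono C s) auto
    also have "\<dots> < inverse (real (Suc m)) / C * C"
      using d(2)[of "of_rat q"] q C(1) by (intro mult_strict_right_mono) auto
    finally show False using s(2) C(1) by simp
  qed
qed

text \<open>The interior is open, so a segment that meets it does so at a rational parameter. This
  again leaves a countable quantifier for measurability.\<close>

lemma admissible_iff:
  "admissible x n \<theta> \<longleftrightarrow>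
     (\<forall>r::rat. 0 \<le> r \<and> r \<le> 1 \<longrightarrow> x n + of_rat r *\<^sub>R cis \<theta> \<notin> interior (hull_upto x n))"
proof -
  have seg: "y \<in> closed_segment (x n) (x n + cis \<theta>) \<longleftrightarrow> (\<exists>t. 0 \<le> t \<and> t \<le> 1 \<and> y = x n + t *\<^sub>R cis \<theta>)" for y
    by (auto simp: in_segment algebra_simps)
  show ?thesis
  proof
    assume "admissible x n \<theta>"
    then show "\<forall>r::rat. 0 \<le> r \<and> r \<le> 1 \<longrightarrow> x n + of_rat r *\<^sub>R cis \<theta> \<notin> interior (hull_upto x n)"
      unfolding admissible_def using seg by force
  next
    assume *: "\<forall>r::rat. 0 \<le> r \<and> r \<le> 1 \<longrightarrow> x n + of_rat r *\<^sub>R cis \<theta> \<notin> interior (hull_upto x n)"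
    show "admissible x n \<theta>"
      unfolding admissible_def
    proof (rule ccontr)
      assume "closed_segment (x n) (x n + cis \<theta>) \<inter> interior (hull_upto x n) \<noteq> {}"
      then obtain t where t: "0 \<le> t" "t \<le> 1" "x n + t *\<^sub>R cis \<theta> \<in> interior (hull_upto x n)"
        using seg by auto
      have "open ((\<lambda>t. x n + t *\<^sub>R cis \<theta>) -` interior (hull_upto x n))"
        by (intro open_vimage continuous_intros) auto
      then obtain d where d: "d > 0" "ball t d \<subseteq> (\<lambda>t. x n + t *\<^sub>R cis \<theta>) -` interior (hull_upto x n)"
        using t(3) by (meson openE vimageI)
      have "max 0 (t - d) < min 1 (t + d)" using t d(1) by auto
      then obtain q :: rat where q: "max 0 (t - d) < of_rat q" "of_rat q < min 1 (t + d)"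
        using of_rat_dense by blast
      have "of_rat q \<in> ball t d" using q by (auto simp: dist_real_def)
      moreover have "0 \<le> q" "q \<le> 1" using q 
        by (simp_all add: less_imp_le)
      ultimately show False using * d(2) by auto
    qed
  qed
qed

text \<open>The offset is one-sided, so that the angle is enclosed by the grid points
  \<open>j\<close> and \<open>j + 1\<close>; \<open>exists_uncovered_direction\<close> needs a grid
  direction on each side of the normal.\<close>

lemma exists_cis_grid_near:
  fixes \<epsilon> :: real
  assumes m: "m > 0" and \<epsilon>: "\<epsilon> = 2 * pi / real m"
  obtains j \<alpha> where "j < m" "0 \<le> \<alpha>" "\<alpha> \<le> \<epsilon>" "cis \<phi> = cis (real j * \<epsilon> + \<alpha>)"
proof -
  have me: "real m * \<epsilon> = 2 * pi" "\<epsilon> > 0" using m \<epsilon> by auto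
  define k where "k = \<lfloor>\<phi> / \<epsilon>\<rfloor>"
  have k: "of_int k * \<epsilon> \<le> \<phi>" "\<phi> < (of_int k + 1) * \<epsilon>"
    unfolding k_def using me(2) by (simp_all add: pos_le_divide_eq[symmetric] pos_divide_less_eq[symmetric])
  define j where "j = nat (k mod int m)"
  have j: "int j = k mod int m" "j < m"
    unfolding j_def using m by (auto simp: nat_less_iff)
  have "k = int m * (k div int m) + int j" using j(1) by simp
  then have "real_of_int k = real m * of_int (k div int m) + real j"
    by (metis of_int_add of_int_mult of_int_of_nat_eq)
  then have kk: "of_int k * \<epsilon> = real j * \<epsilon> + 2 * pi * of_int (k div int m)"
    using me(1) by (simp add: algebra_simps)
  show thesis
  proof (rule that[of j "\<phi> - of_int k * \<epsilon>"])
    show "cis \<phi> = cis (real j * \<epsilon> + (\<phi> - of_int k * \<epsilon>))"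
    proof -
      have "\<phi> = (real j * \<epsilon> + (\<phi> - of_int k * \<epsilon>)) + 2 * pi * of_int (k div int m)"
        using kk by simp
      then have "cis \<phi> = cis (real j * \<epsilon> + (\<phi> - of_int k * \<epsilon>)) * cis (2 * pi * of_int (k div int m))"
        by (metis cis_mult)
      then show ?thesis by (simp add: cis_multiple_2pi)
    qed
  qed (use j k in \<open>auto simp: algebra_simps\<close>)
qed

section \<open>Penalised support functions and returns of the walk\<close>

text \<open>The support function of the past, with a discount of \<open>\<delta>\<close> per unit of time. Thanks to the discount, a
  past point can block a direction close to an outer normal at \<open>x n\<close> only if it lies at a distance from
  \<open>x n\<close> that is linear in the time elapsed since its visit.\<close>

primrec pen_support :: "real \<Rightarrow> complex \<Rightarrow> (nat \<Rightarrow> complex) \<Rightarrow> nat \<Rightarrow> real" where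
  "pen_support \<delta> e x 0 = e \<bullet> x 0"
| "pen_support \<delta> e x (Suc n) = max (pen_support \<delta> e x n - \<delta>) (e \<bullet> x (Suc n))"

lemma pen_support_attained: "\<exists>s\<le>n. pen_support \<delta> e x n = e \<bullet> x s - \<delta> * real (n - s)"
proof (induction n)
  case (Suc n)
  then obtain s where s: "s \<le> n" "pen_support \<delta> e x n = e \<bullet> x s - \<delta> * real (n - s)" by blast
  show ?case
  proof (cases "pen_support \<delta> e x n - \<delta> \<ge> e \<bullet> x (Suc n)")
    case True
    then show ?thesis using s
      by (intro exI[of _ s]) (auto simp: Suc_diff_le algebra_simps max_def)
  next
    case False
    then show ?thesis by (intro exI[of _ "Suc n"]) auto
  qed
qed auto

text \<open>A cone around the ray through \<open>u\<close>, described by the relative distance to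
  that ray instead of an angle. The triangle inequality then applies directly, and 0 belongs to
  every sector.\<close>

definition in_sector :: "real \<Rightarrow> complex \<Rightarrow> complex \<Rightarrow> bool" where
  "in_sector \<epsilon> u z \<longleftrightarrow> norm (z - norm z *\<^sub>R u) \<le> \<epsilon> * norm z"

text \<open>Ties are broken by the least index, so that at most one \<open>i\<close> is selected. The selection depends only on
  the path up to time \<open>s\<close>; this is what replaces a union bound over all earlier points.\<close>

definition farthest :: "real \<Rightarrow> complex \<Rightarrow> (nat \<Rightarrow> complex) \<Rightarrow> nat \<Rightarrow> nat \<Rightarrow> bool" where
  "farthest \<epsilon> u x s i \<longleftrightarrow> i \<le> s \<and> in_sector \<epsilon> u (x i - x s) \<and>
     (\<forall>k\<in>{..s}. in_sector \<epsilon> u (x k - x s) \<longrightarrow> norm (x k - x s) \<le> norm (x i - x s)) \<and>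
     (\<forall>k\<in>{..<i}. in_sector \<epsilon> u (x k - x s) \<longrightarrow> norm (x k - x s) < norm (x i - x s))"

lemma farthest_unique:
  assumes "farthest \<epsilon> u x s i" "farthest \<epsilon> u x s k"
  shows "i = k"
proof (rule ccontr)
  assume "i \<noteq> k"
  then consider "i < k" | "k < i" by linarith
  then show False
    by cases (use assms in \<open>force simp: farthest_def\<close>)+
qed

lemma farthest_exists:
  assumes "k \<le> s" "in_sector \<epsilon> u (x k - x s)"
  obtains i where "farthest \<epsilon> u x s i"
proof -
  define I where "I = {k. k \<le> s \<and> in_sector \<epsilon> u (x k - x s)}"
  have I: "finite I" "I \<noteq> {}" using assms by (auto simp: I_def)
  define R where "R = Max ((\<lambda>k. norm (x k - x s)) ` I)"
  have R: "norm (x k - x s) \<le> R" if "k \<in> I" for k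
    unfolding R_def using I that by (intro Max_ge) auto
  have "R \<in> (\<lambda>k. norm (x k - x s)) ` I"
    unfolding R_def using I by (intro Max_in) auto
  then have ex: "\<exists>i. i \<in> I \<and> norm (x i - x s) = R" by blast
  define i where "i = (LEAST i. i \<in> I \<and> norm (x i - x s) = R)"
  have i: "i \<in> I" "norm (x i - x s) = R"
    using LeastI_ex[OF ex] by (auto simp: i_def)
  have less: "norm (x k - x s) < R" if "k < i" "k \<in> I" for k
    using not_less_Least[of k "\<lambda>i. i \<in> I \<and> norm (x i - x s) = R"] that R[of k] by (auto simp: i_def)
  have "farthest \<epsilon> u x s i"
    unfolding farthest_def using i R less by (auto simp: I_def)
  then show thesis by (rule that)
qed

lemma farthest_cong:
  assumes "\<And>k. k \<le> s \<Longrightarrow> x k = y k"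
  shows "farthest \<epsilon> u x s i = farthest \<epsilon> u y s i"
  unfolding farthest_def using assms
  by (intro conj_cong refl ball_cong imp_cong) auto

definition grid :: "nat \<Rightarrow> nat \<Rightarrow> complex" where
  "grid m j = cis (real j * (2 * pi / real m))"

lemma norm_grid [simp]: "norm (grid m j) = 1"
  by (simp add: grid_def)

text \<open>The weight of the point \<open>x i\<close> among the supermartingales started at time
  \<open>s\<close>. A point counts once for every grid sector in which it is selected, so the total
  weight handed out at one time is at most \<open>m\<close>, however long the past is.\<close>

definition far_count :: "nat \<Rightarrow> (nat \<Rightarrow> complex) \<Rightarrow> nat \<Rightarrow> nat \<Rightarrow> real" where
  "far_count m x s i = (\<Sum>j<m. of_bool (farthest (2 * pi / real m) (grid m j) x s i))"

lemma far_count_nonneg: "0 \<le> far_count m x s i"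
  by (simp add: far_count_def sum_nonneg)

lemma far_count_sum_le: "(\<Sum>i\<le>s. far_count m x s i) \<le> real m"
proof -
  have "(\<Sum>i\<le>s. of_bool (farthest (2 * pi / real m) (grid m j) x s i)) \<le> (1::real)" for j
  proof -
    let ?P = "farthest (2 * pi / real m) (grid m j) x s"
    have "(\<Sum>i\<le>s. of_bool (?P i) :: real) = real (card {i\<in>{..s}. ?P i})"
      by (simp add: of_bool_def sum.If_cases Int_def)
    also have "card {i\<in>{..s}. ?P i} \<le> 1"
      by (auto simp: card_le_Suc0_iff_eq dest: farthest_unique)
    finally show ?thesis by simp
  qed
  then have "(\<Sum>j<m. \<Sum>i\<le>s. of_bool (farthest (2 * pi / real m) (grid m j) x s i)) \<le> (\<Sum>j<m. 1::real)"
    by (intro sum_mono) auto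
  then show ?thesis
    unfolding far_count_def by (subst sum.swap) simp
qed

text \<open>The dependence on \<open>n\<close> of each term is that of the exponential supermartingale attached to the
  submartingale \<open>dist (x n) (x i)\<close>, started at time \<open>s\<close> and damped by a further factor \<open>exp (- \<mu>\<^sup>2)\<close> per step.\<close>

definition return_sum ::
    "((nat \<Rightarrow> complex) \<Rightarrow> nat \<Rightarrow> nat \<Rightarrow> real) \<Rightarrow> real \<Rightarrow> nat \<Rightarrow> (nat \<Rightarrow> complex) \<Rightarrow> real" where
  "return_sum a \<mu> n x = (\<Sum>s\<le>n. \<Sum>i\<le>s. a x s i *
     exp (\<mu> * (dist (x s) (x i) - dist (x n) (x i)) - 2 * \<mu>\<^sup>2 * real (n - s)))"

lemma return_sum_nonneg:
  assumes "\<And>s i. 0 \<le> a x s i"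
  shows "0 \<le> return_sum a \<mu> n x"
  unfolding return_sum_def by (intro sum_nonneg mult_nonneg_nonneg assms) auto

lemma return_sum_ge:
  assumes "\<And>s i. 0 \<le> a x s i" "s \<le> n" "i \<le> s" "1 \<le> a x s i"
    "c \<le> \<mu> * (dist (x s) (x i) - dist (x n) (x i)) - 2 * \<mu>\<^sup>2 * real (n - s)"
  shows "exp c \<le> return_sum a \<mu> n x"
proof -
  let ?t = "\<lambda>s i. a x s i * exp (\<mu> * (dist (x s) (x i) - dist (x n) (x i)) - 2 * \<mu>\<^sup>2 * real (n - s))"
  have nn: "0 \<le> ?t s i" for s i by (intro mult_nonneg_nonneg assms(1)) auto
  have "exp c \<le> 1 * exp (\<mu> * (dist (x s) (x i) - dist (x n) (x i)) - 2 * \<mu>\<^sup>2 * real (n - s))"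
    using assms(5) by simp
  also have "\<dots> \<le> ?t s i" using assms(4) by (intro mult_right_mono) auto
  also have "\<dots> \<le> (\<Sum>i\<le>s. ?t s i)"
    by (intro member_le_sum[of i "{..s}" "\<lambda>i. ?t s i"] nn) (use assms(3) in auto)
  also have "\<dots> \<le> (\<Sum>s\<le>n. \<Sum>i\<le>s. ?t s i)"
    by (intro member_le_sum[of s "{..n}" "\<lambda>s. \<Sum>i\<le>s. ?t s i"] sum_nonneg nn) (use assms(2) in auto)
  finally show ?thesis by (simp add: return_sum_def)
qed

section \<open>Plane geometry of two blocking points\<close>

text \<open>Split off from \<open>z\<close> a piece of length \<xi> and turn its direction from
  \<open>z\<close> to \<open>u\<close>, to \<open>z1\<close>, to \<open>f\<close> and finally to
  \<open>zn\<close>. The errors are \<epsilon> \<xi>, \<epsilon> \<xi>, 4 \<epsilon> \<xi> and 2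
  \<epsilon> \<xi>, in total 8 \<epsilon> \<xi> <= \<xi> / 2, so subtracting \<open>zn\<close>
  shortens \<open>z\<close> by at least half of \<xi>.\<close>

lemma sector_drop:
  fixes z z1 zn u f :: complex and \<xi> \<epsilon> :: real
  assumes "in_sector \<epsilon> u z" "in_sector \<epsilon> u z1"
    and "norm (z1 - norm z1 *\<^sub>R f) \<le> 4 * \<epsilon> * norm z1" "norm (zn - \<xi> *\<^sub>R f) \<le> 2 * \<epsilon> * \<xi>"
    and "0 < \<xi>" "\<xi> \<le> norm z1" "norm z1 \<le> norm z" "\<epsilon> \<le> 1 / 16"
  shows "\<xi> / 2 \<le> norm z - norm (z - zn)"
proof -
  define R R1 where "R = norm z" and "R1 = norm z1"
  have R: "R > 0" "R1 > 0" "\<xi> \<le> R" using assms by (auto simp: R_def R1_def)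
  have eq: "z - zn = (1 - \<xi> / R) *\<^sub>R z + (\<xi> / R) *\<^sub>R (z - R *\<^sub>R u) - (\<xi> / R1) *\<^sub>R (z1 - R1 *\<^sub>R u)
      + (\<xi> / R1) *\<^sub>R (z1 - R1 *\<^sub>R f) - (zn - \<xi> *\<^sub>R f)"
    using R by (simp add: algebra_simps)
  have "norm (z - zn) \<le> norm ((1 - \<xi> / R) *\<^sub>R z) + norm ((\<xi> / R) *\<^sub>R (z - R *\<^sub>R u))
      + norm ((\<xi> / R1) *\<^sub>R (z1 - R1 *\<^sub>R u)) + norm ((\<xi> / R1) *\<^sub>R (z1 - R1 *\<^sub>R f)) + norm (zn - \<xi> *\<^sub>R f)"
  proof -
    have "norm (a + b - c + d - e) \<le> norm a + norm b + norm c + norm d + norm e" for a b c d e :: complex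
      by norm
    then show ?thesis unfolding eq by blast
  qed
  also have "norm ((1 - \<xi> / R) *\<^sub>R z) = R - \<xi>"
    using R assms(5) by (simp add: R_def field_simps)
  also have "norm ((\<xi> / R) *\<^sub>R (z - R *\<^sub>R u)) \<le> (\<xi> / R) * (\<epsilon> * R)"
    unfolding norm_scaleR using assms(1,5) R by (intro mult_mono) (auto simp: in_sector_def R_def)
  also have "norm ((\<xi> / R1) *\<^sub>R (z1 - R1 *\<^sub>R u)) \<le> (\<xi> / R1) * (\<epsilon> * R1)"
    unfolding norm_scaleR using assms(2,5) R by (intro mult_mono) (auto simp: in_sector_def R1_def)
  also have "norm ((\<xi> / R1) *\<^sub>R (z1 - R1 *\<^sub>R f)) \<le> (\<xi> / R1) * (4 * \<epsilon> * R1)"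
    unfolding norm_scaleR using assms(3,5) R by (intro mult_mono) (auto simp: R1_def)
  also note assms(4)
  finally have "norm (z - zn) \<le> R - \<xi> + 8 * (\<epsilon> * \<xi>)"
    using R by (simp add: algebra_simps)
  moreover have "\<epsilon> * \<xi> \<le> (1/16) * \<xi>" using assms by (intro mult_right_mono) auto
  ultimately show ?thesis by (simp add: R_def)
qed

text \<open>The walker is at the origin, sees \<open>w1\<close> and \<open>w2\<close> in almost opposite directions, and has visited \<open>w2\<close> last;
  \<open>z\<close> points from \<open>w2\<close> to the farthest point in the sector of \<open>w1\<close>. Since its visit to \<open>w2\<close> the walker has
  then come closer to that point.\<close>

lemma opposite_witnesses_drop:
  fixes w1 w2 f v :: complex
  assumes "norm f = 1" "norm v = 1" "f \<bullet> v = 0"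
    and w1: "w1 = A *\<^sub>R f - y1 *\<^sub>R v" and w2: "w2 = - \<xi> *\<^sub>R f - y2 *\<^sub>R v"
    and pos: "0 < A" "0 < \<xi>" and y: "0 \<le> y1" "y1 \<le> 2 * \<epsilon> * A" "0 \<le> y2" "y2 \<le> 2 * \<epsilon> * \<xi>"
    and sec: "in_sector \<epsilon> u (w1 - w2)" "in_sector \<epsilon> u z" "norm (w1 - w2) \<le> norm z" "\<epsilon> \<le> 1 / 16"
  shows "\<xi> / 2 \<le> norm z - norm (z + w2)"
proof -
  define z1 where "z1 = w1 - w2"
  have z1: "z1 = (A + \<xi>) *\<^sub>R f + (y2 - y1) *\<^sub>R v" by (simp add: z1_def w1 w2 algebra_simps)
  have "f \<bullet> z1 = A + \<xi>" using assms(1,3) by (simp add: z1 inner_add_right dot_square_norm)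
  then have ge: "A + \<xi> \<le> norm z1"
    using norm_cauchy_schwarz[of f z1] assms(1) by simp
  have "norm z1 \<le> norm ((A + \<xi>) *\<^sub>R f) + norm ((y2 - y1) *\<^sub>R v)" unfolding z1 by (rule norm_triangle_ineq)
  then have le: "norm z1 \<le> A + \<xi> + \<bar>y2 - y1\<bar>" using assms(1,2) pos by simp
  have e0: "0 \<le> \<epsilon>" using order_trans[OF y(1,2)] pos(1) by (simp add: zero_le_mult_iff)
  have "2 * \<epsilon> * A \<le> 2 * \<epsilon> * (A + \<xi>)" "2 * \<epsilon> * \<xi> \<le> 2 * \<epsilon> * (A + \<xi>)"
    using e0 pos by (auto intro!: mult_left_mono)
  then have "\<bar>y2 - y1\<bar> \<le> 2 * \<epsilon> * (A + \<xi>)" using y by linarith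
  also have "\<dots> \<le> 2 * \<epsilon> * norm z1" using ge e0 by (intro mult_left_mono) auto
  finally have yy: "\<bar>y2 - y1\<bar> \<le> 2 * \<epsilon> * norm z1" .
  have "z1 - norm z1 *\<^sub>R f = (y2 - y1) *\<^sub>R v - (norm z1 - (A + \<xi>)) *\<^sub>R f"
    by (simp add: z1 algebra_simps)
  then have "norm (z1 - norm z1 *\<^sub>R f) \<le> norm ((y2 - y1) *\<^sub>R v) + norm ((norm z1 - (A + \<xi>)) *\<^sub>R f)"
    by (metis norm_triangle_ineq4)
  \<comment> \<open>The transversal part of \<open>z1\<close> and the excess of its length over
    \<open>A + \<xi>\<close> are each at most \<open>\<bar>y2 - y1\<bar>\<close>; this doubles the
    factor 2 \<epsilon> to the 4 \<epsilon> of \<open>sector_drop\<close>.\<close>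
  also have "\<dots> \<le> 2 * \<bar>y2 - y1\<bar>" using assms(1,2) ge le by simp
  also have "\<dots> \<le> 4 * \<epsilon> * norm z1" using yy by simp
  finally have 1: "norm (z1 - norm z1 *\<^sub>R f) \<le> 4 * \<epsilon> * norm z1" .
  have 2: "norm (- w2 - \<xi> *\<^sub>R f) \<le> 2 * \<epsilon> * \<xi>"
    using y assms(2) by (simp add: w2)
  have "\<xi> / 2 \<le> norm z - norm (z - (- w2))"
    by (rule sector_drop[OF sec(2) _ 1 2]) (use sec ge pos in \<open>auto simp: z1_def\<close>)
  then show ?thesis by simp
qed

text \<open>In the orthonormal frame \<open>f\<close>, \<open>v\<close> write w = X f - y v with y
  >= 0. The hypothesis becomes c + y cos \<alpha> < X sin \<alpha>, and sin \<alpha> <= \<epsilon>,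
  cos \<alpha> >= 1/2. So an advantage \<open>c\<close> in the slightly tilted direction forces a
  distance of at least c / \<epsilon>, almost orthogonal to the normal.\<close>

lemma tilted_witness:
  fixes v f w :: complex
  assumes v: "norm v = 1" and f: "f = \<i> * v \<or> f = - (\<i> * v)"
    and \<alpha>: "0 \<le> \<alpha>" "\<alpha> \<le> \<epsilon>" "\<epsilon> \<le> 1 / 16"
    and c: "0 < c" "c < (cos \<alpha> *\<^sub>R v + sin \<alpha> *\<^sub>R f) \<bullet> w" and vw: "v \<bullet> w \<le> 0"
  obtains X y where "w = X *\<^sub>R f - y *\<^sub>R v" "c < \<epsilon> * X" "0 < X" "0 \<le> y" "y \<le> 2 * \<epsilon> * X"
proof (rule that[of "f \<bullet> w" "- (v \<bullet> w)"])
  have v2: "(Re v)\<^sup>2 + (Im v)\<^sup>2 = 1" using v by (simp add: cmod_def)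
  have "w = (f \<bullet> w) *\<^sub>R f + (v \<bullet> w) *\<^sub>R v"
  proof -
    have "Re w = Re w * ((Re v)\<^sup>2 + (Im v)\<^sup>2)" "Im w = Im w * ((Re v)\<^sup>2 + (Im v)\<^sup>2)" by (simp_all add: v2)
    then show ?thesis using f
      by (auto simp: complex_eq_iff inner_complex_def power2_eq_square algebra_simps)
  qed
  then show "w = (f \<bullet> w) *\<^sub>R f - (- (v \<bullet> w)) *\<^sub>R v" by simp
  show "0 \<le> - (v \<bullet> w)" using vw by simp
  have a1: "\<alpha> \<le> 1" using \<alpha> by simp
  have pi3: "3 < pi" by (rule pi_gt3)
  have s: "0 \<le> sin \<alpha>" "sin \<alpha> \<le> \<epsilon>"
    using \<alpha> a1 pi3 sin_x_le_x[of \<alpha>] by (auto intro!: sin_ge_zero)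
  have "cos (pi/3) \<le> cos \<alpha>"
    by (rule cos_monotone_0_pi_le) (use \<alpha> a1 pi3 in auto)
  then have co: "1/2 \<le> cos \<alpha>" by (simp add: cos_60)
  have key: "c + cos \<alpha> * (- (v \<bullet> w)) < sin \<alpha> * (f \<bullet> w)"
    using c(2) by (simp add: inner_add_left algebra_simps)
  have nn: "0 \<le> cos \<alpha> * (- (v \<bullet> w))" using co vw by (intro mult_nonneg_nonneg) auto
  have "0 < sin \<alpha> * (f \<bullet> w)" using key nn c(1) by linarith
  then show X: "0 < f \<bullet> w" using s(1) by (auto simp: zero_less_mult_iff)
  have sX: "sin \<alpha> * (f \<bullet> w) \<le> \<epsilon> * (f \<bullet> w)" using s X by (intro mult_right_mono) auto
  show "c < \<epsilon> * (f \<bullet> w)" using key nn sX by linarith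
  have "(1/2) * (- (v \<bullet> w)) \<le> cos \<alpha> * (- (v \<bullet> w))" using co vw by (intro mult_right_mono) auto
  then show "- (v \<bullet> w) \<le> 2 * \<epsilon> * (f \<bullet> w)" using key sX c(1) by linarith
qed

lemma exists_in_sector:
  assumes "m > 0"
  obtains j where "j < m" "in_sector (2 * pi / real m) (grid m j) z"
proof (cases "z = 0")
  case True
  then show thesis using assms by (intro that[of 0]) (auto simp: in_sector_def)
next
  case False
  obtain j \<alpha> where j: "j < m" "0 \<le> \<alpha>" "\<alpha> \<le> 2 * pi / real m"
    "cis (Arg z) = cis (real j * (2 * pi / real m) + \<alpha>)"
    using exists_cis_grid_near[OF assms refl, of "Arg z"] by blast
  have "z = norm z *\<^sub>R cis (Arg z)" using False by (simp add: cis_Arg sgn_div_norm)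
  then have "z - norm z *\<^sub>R grid m j = norm z *\<^sub>R (cis (Arg z) - grid m j)"
    by (metis scaleR_diff_right)
  then have "norm (z - norm z *\<^sub>R grid m j) = norm z * norm (cis (Arg z) - grid m j)" by simp
  also have "norm (cis (Arg z) - grid m j) \<le> \<alpha>"
    unfolding j(4) grid_def using norm_cis_diff_le[of "real j * (2 * pi / real m) + \<alpha>" "real j * (2 * pi / real m)"] j(2)
    by simp
  also have "norm z * \<alpha> \<le> 2 * pi / real m * norm z"
    using mult_right_mono[OF j(3) norm_ge_zero[of z]] by (simp add: mult.commute)
  finally show thesis using j(1) by (intro that[of j]) (auto simp: in_sector_def mult_left_mono)
qed

text \<open>The blocking point \<open>x i\<close> need not be the selected one of its sector as seen
  from \<open>x s\<close>, and only the selected one carries weight. The drop is therefore required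
  for every \<open>z\<close> of the same sector that is at least as long, and is applied to the
  selected point.\<close>

lemma drop_le_return_sum:
  assumes m: "m > 0" and ik: "i \<le> s" "s \<le> n"
    and drop: "\<And>z u. in_sector (2 * pi / real m) u (x i - x s) \<Longrightarrow> in_sector (2 * pi / real m) u z \<Longrightarrow>
        norm (x i - x s) \<le> norm z \<Longrightarrow> \<xi> / 2 \<le> norm z - norm (z + (x s - x n))"
    and \<mu>: "0 \<le> \<mu>" and c: "c + 2 * \<mu>\<^sup>2 * real (n - s) \<le> \<mu> * (\<xi> / 2)"
  shows "exp c \<le> return_sum (far_count m) \<mu> n x"
proof -
  obtain j where j: "j < m" "in_sector (2 * pi / real m) (grid m j) (x i - x s)"
    using exists_in_sector[OF m] by blast
  obtain k where k: "farthest (2 * pi / real m) (grid m j) x s k"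
    using farthest_exists[OF ik(1) j(2)] by blast
  have "\<xi> / 2 \<le> norm (x k - x s) - norm (x k - x s + (x s - x n))"
    by (rule drop[OF j(2)]) (use k ik j(2) in \<open>auto simp: farthest_def\<close>)
  then have "\<xi> / 2 \<le> dist (x s) (x k) - dist (x n) (x k)"
    by (simp add: dist_norm norm_minus_commute)
  then have "\<mu> * (\<xi> / 2) \<le> \<mu> * (dist (x s) (x k) - dist (x n) (x k))"
    using \<mu> by (rule mult_left_mono)
  then have le: "c \<le> \<mu> * (dist (x s) (x k) - dist (x n) (x k)) - 2 * \<mu>\<^sup>2 * real (n - s)"
    using c by linarith
  have "of_bool (farthest (2 * pi / real m) (grid m j) x s k) \<le> far_count m x s k"
    unfolding far_count_def using j(1)
    by (intro member_le_sum[of j "{..<m}" "\<lambda>j. of_bool (farthest (2 * pi / real m) (grid m j) x s k)"]) auto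
  then show ?thesis
    using k le ik by (intro return_sum_ge[of _ _ s n k]) (auto simp: far_count_nonneg farthest_def)
qed

text \<open>If both grid directions adjacent to the outer normal \<open>v\<close> were blocked by past points, these points would
  be seen from \<open>x n\<close> in almost opposite directions and at large distance, so one of the submartingales in
  \<open>return_sum\<close> would have dropped.\<close>

lemma exists_uncovered_direction:
  assumes m: "m \<ge> 128" and v: "norm v = 1" "\<And>s. s \<le> n \<Longrightarrow> v \<bullet> x s \<le> v \<bullet> x n"
    and \<delta>: "0 \<le> \<delta>" and \<mu>: "\<mu> = \<delta> * real m / (8 * pi)"
    and small: "return_sum (far_count m) \<mu> n x < exp (\<mu> * real m / (16 * pi))"
  shows "\<exists>j<m. norm (grid m j - v) \<le> 2 * pi / real m \<and>
    pen_support \<delta> (grid m j) x n - 1 / 4 \<le> grid m j \<bullet> x n"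
proof (rule ccontr)
  assume "\<not> ?thesis"
  then have contra: "grid m j \<bullet> x n < pen_support \<delta> (grid m j) x n - 1 / 4"
    if "j < m" "norm (grid m j - v) \<le> 2 * pi / real m" for j
    using that by (meson not_le)
  define \<epsilon> where "\<epsilon> = 2 * pi / real m"
  have m0: "m > 0" and \<epsilon>: "\<epsilon> > 0" "\<epsilon> \<le> 1 / 16" "real m * \<epsilon> = 2 * pi"
    using m pi_less_4 by (auto simp: \<epsilon>_def field_simps)
  have witness: "\<exists>s\<le>n. 1 / 4 + \<delta> * real (n - s) < grid m j \<bullet> (x s - x n)"
    if "j < m" "norm (grid m j - v) \<le> \<epsilon>" for j
    using contra[OF that[unfolded \<epsilon>_def]] pen_support_attained[of n \<delta> "grid m j" x]
    by (force simp: inner_diff_right)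
  obtain t where t: "v = cis t" using v(1) by (rule norm_eq_1_cis)
  obtain j \<alpha> where j: "j < m" "0 \<le> \<alpha>" "\<alpha> \<le> \<epsilon>" "cis t = cis (real j * \<epsilon> + \<alpha>)"
    using exists_cis_grid_near[OF m0 \<epsilon>_def, of t] by blast
  \<comment> \<open>The other neighbour of the normal; the index wraps around because
    \<open>m\<close> grid steps make a full turn.\<close>
  define k where "k = (if Suc j < m then Suc j else 0)"
  have k: "k < m" "grid m k = cis (real (Suc j) * \<epsilon>)"
  proof -
    show "k < m" using m0 by (simp add: k_def)
    have "cis (real (Suc j) * \<epsilon>) = 1" if "\<not> Suc j < m"
    proof -
      have "Suc j = m" using that j(1) by simp
      then show ?thesis using \<epsilon>(3) cis_2pi by metis
    qed
    then show "grid m k = cis (real (Suc j) * \<epsilon>)" by (auto simp: k_def grid_def \<epsilon>_def)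
  qed
  define f where "f = - (\<i> * v)"
  have cis_tilt: "cis (r + b) = cos b *\<^sub>R cis r + sin b *\<^sub>R (\<i> * cis r)" for r b
    by (simp add: complex_eq_iff cos_add sin_add algebra_simps)
  have gj: "grid m j = cos \<alpha> *\<^sub>R v + sin \<alpha> *\<^sub>R f"
    using cis_tilt[of "real j * \<epsilon> + \<alpha>" "- \<alpha>"] j(4) by (simp add: grid_def \<epsilon>_def f_def t)
  have gk: "grid m k = cos (\<epsilon> - \<alpha>) *\<^sub>R v + sin (\<epsilon> - \<alpha>) *\<^sub>R (\<i> * v)"
    using cis_tilt[of "real j * \<epsilon> + \<alpha>" "\<epsilon> - \<alpha>"] j(4) by (simp add: k t algebra_simps)
  have "norm (grid m j - v) \<le> \<epsilon>"
    using norm_cis_diff_le[of "real j * \<epsilon>" "real j * \<epsilon> + \<alpha>"] j by (simp add: grid_def t \<epsilon>_def)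
  then obtain s1 where s1: "s1 \<le> n" "1 / 4 + \<delta> * real (n - s1) < grid m j \<bullet> (x s1 - x n)"
    using witness j(1) by blast
  have "norm (grid m k - v) \<le> \<epsilon>"
    using norm_cis_diff_le[of "real (Suc j) * \<epsilon>" "real j * \<epsilon> + \<alpha>"] j by (simp add: k t algebra_simps)
  then obtain s2 where s2: "s2 \<le> n" "1 / 4 + \<delta> * real (n - s2) < grid m k \<bullet> (x s2 - x n)"
    using witness k(1) by blast
  obtain A y1 where A: "x s1 - x n = A *\<^sub>R f - y1 *\<^sub>R v" "1 / 4 + \<delta> * real (n - s1) < \<epsilon> * A"
      "0 < A" "0 \<le> y1" "y1 \<le> 2 * \<epsilon> * A"
    by (rule tilted_witness[OF v(1) _ j(2,3) \<epsilon>(2) _ s1(2)[unfolded gj]])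
      (use \<delta> v(2)[OF s1(1)] in \<open>auto simp: f_def inner_diff_right add_pos_nonneg\<close>)
  obtain B y2 where B: "x s2 - x n = B *\<^sub>R (\<i> * v) - y2 *\<^sub>R v" "1 / 4 + \<delta> * real (n - s2) < \<epsilon> * B"
      "0 < B" "0 \<le> y2" "y2 \<le> 2 * \<epsilon> * B"
    by (rule tilted_witness[OF v(1) _ _ _ \<epsilon>(2) _ s2(2)[unfolded gk]])
      (use \<delta> v(2)[OF s2(1)] j in \<open>auto simp: inner_diff_right add_pos_nonneg\<close>)
  have ortho: "norm f = 1" "f \<bullet> v = 0" "norm (\<i> * v) = 1" "(\<i> * v) \<bullet> v = 0" "\<i> * v = - f"
    using v(1) by (auto simp: f_def norm_mult inner_complex_def)
  have \<mu>0: "0 \<le> \<mu>" using \<mu> \<delta> by simp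
  have \<mu>\<epsilon>: "4 * \<mu> * \<epsilon> = \<delta>" using m0 by (simp add: \<mu> \<epsilon>_def)
  \<comment> \<open>\<mu> is tuned to 4 \<mu> \<epsilon> = \<delta>. The part of the distance that
    comes from the discount then pays exactly for the damping over time \<open>T\<close>, and the
    slack 1/4 leaves \<mu> / (8 \<epsilon>), which is the threshold exponent.\<close>
  have expo: "\<mu> * real m / (16 * pi) + 2 * \<mu>\<^sup>2 * T \<le> \<mu> * (\<xi> / 2)" if "1 / 4 + \<delta> * T < \<epsilon> * \<xi>" for T \<xi>
  proof -
    have "1 / (4 * \<epsilon>) + 4 * \<mu> * T < \<xi>"
      using that \<epsilon>(1) by (simp add: \<mu>\<epsilon>[symmetric] field_simps)
    then have "\<mu> * ((1 / (4 * \<epsilon>) + 4 * \<mu> * T) / 2) \<le> \<mu> * (\<xi> / 2)"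
      using \<mu>0 by (intro mult_left_mono) auto
    moreover have "\<mu> * ((1 / (4 * \<epsilon>) + 4 * \<mu> * T) / 2) = \<mu> * real m / (16 * pi) + 2 * \<mu>\<^sup>2 * T"
      by (simp add: \<epsilon>_def power2_eq_square algebra_simps)
    ultimately show ?thesis by simp
  qed
  have "exp (\<mu> * real m / (16 * pi)) \<le> return_sum (far_count m) \<mu> n x"
  \<comment> \<open>The drop is counted from the later of the two visits, and its size is the
    horizontal distance of the point visited then.\<close>
  proof (cases "s1 \<le> s2")
    case True
    show ?thesis
    proof (rule drop_le_return_sum[OF m0 True s2(1) _ \<mu>0 expo[OF B(2)]])
      fix z u
      assume sec: "in_sector (2 * pi / real m) u (x s1 - x s2)" "in_sector (2 * pi / real m) u z"
        "norm (x s1 - x s2) \<le> norm z"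
      show "B / 2 \<le> norm z - norm (z + (x s2 - x n))"
      proof (rule opposite_witnesses_drop[OF ortho(1) v(1) ortho(2) A(1) _ A(3) B(3) A(4,5) B(4,5) _ _ _ \<epsilon>(2)])
        show "x s2 - x n = - B *\<^sub>R f - y2 *\<^sub>R v" using B(1) ortho(5) by simp
      qed (use sec in \<open>simp_all add: \<epsilon>_def\<close>)
    qed
  next
    case False
    show ?thesis
    proof (rule drop_le_return_sum[OF m0 _ s1(1) _ \<mu>0 expo[OF A(2)]])
      show "s2 \<le> s1" using False by simp
      fix z u
      assume sec: "in_sector (2 * pi / real m) u (x s2 - x s1)" "in_sector (2 * pi / real m) u z"
        "norm (x s2 - x s1) \<le> norm z"
      show "A / 2 \<le> norm z - norm (z + (x s1 - x n))"
      proof (rule opposite_witnesses_drop[OF ortho(3) v(1) ortho(4) B(1) _ B(3) A(3) B(4,5) A(4,5) _ _ _ \<epsilon>(2)])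
        show "x s1 - x n = - A *\<^sub>R (\<i> * v) - y1 *\<^sub>R v" using A(1) ortho(5) by simp
      qed (use sec in \<open>simp_all add: \<epsilon>_def\<close>)
    qed
  qed
  then show False using small by simp
qed

section \<open>The law of a single step\<close>

lemma measurable_cis [measurable]: "cis \<in> borel_measurable borel"
  by (intro borel_measurable_continuous_onI continuous_intros)

lemma admissible_cong:
  assumes "\<And>k. k \<le> n \<Longrightarrow> x k = y k" "cis \<theta> = cis \<theta>'"
  shows "admissible x n \<theta> = admissible y n \<theta>'"
proof -
  have "x ` {..n} = y ` {..n}" using assms(1) by (intro image_cong) auto
  then show ?thesis using assms by (simp add: admissible_def hull_upto_def)
qed

lemma pred_mem_interior_hull:
  assumes [measurable]: "\<And>s. s \<le> n \<Longrightarrow> (\<lambda>\<omega>. f \<omega> s) \<in> borel_measurable N" "g \<in> borel_measurable N"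
  shows "Measurable.pred N (\<lambda>\<omega>. g \<omega> \<in> interior (hull_upto (f \<omega>) n))"
  unfolding mem_interior_hull_upto_iff
proof (intro pred_intros_countable pred_intros_finite)
  fix m :: nat and q :: rat and s assume "s \<in> {..n}"
  then have [measurable]: "(\<lambda>\<omega>. f \<omega> s) \<in> borel_measurable N" by (simp add: assms)
  show "Measurable.pred N (\<lambda>\<omega>. inverse (real (Suc m)) \<le> cis (of_rat q) \<bullet> (f \<omega> s - g \<omega>))"
    by measurable
qed auto

text \<open>Path and angle are both allowed to vary: the lemma serves for a fixed path with a
  varying angle and, in the kernel formula, jointly for history and angle.\<close>

lemma pred_admissible:
  assumes [measurable]: "\<And>s. s \<le> n \<Longrightarrow> (\<lambda>\<omega>. f \<omega> s) \<in> borel_measurable N" "g \<in> borel_measurable N"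
  shows "Measurable.pred N (\<lambda>\<omega>. admissible (f \<omega>) n (g \<omega>))"
proof -
  have *: "Measurable.pred N (\<lambda>\<omega>. f \<omega> n + of_rat r *\<^sub>R cis (g \<omega>) \<in> interior (hull_upto (f \<omega>) n))" for r
    by (intro pred_mem_interior_hull) measurable
  show ?thesis
    unfolding admissible_iff using * by measurable
qed

lemma sets_admissible_angles [measurable]: "admissible_angles x n \<in> sets borel"
proof -
  have [measurable]: "Measurable.pred borel (\<lambda>\<theta>. admissible x n \<theta>)"
    by (rule pred_admissible[where f = "\<lambda>_. x"]) auto
  show ?thesis unfolding admissible_angles_def by measurable
qed

section \<open>Reflection of the admissible directions\<close>

lemma integral_periodic_shift:
  fixes k :: "real \<Rightarrow> real"
  assumes [measurable]: "k \<in> borel_measurable borel" and bnd: "\<And>t. \<bar>k t\<bar> \<le> C"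
    and per: "\<And>t. k (t + 2 * pi) = k t" and a: "- 2 * pi \<le> a" "a \<le> 2 * pi"
  shows "(\<integral>t. indicator {a..<a + 2 * pi} t * k t \<partial>lborel) = (\<integral>t. indicator {0..<2 * pi} t * k t \<partial>lborel)"
proof -
  have int: "integrable lborel (\<lambda>t. indicator {u..<v} t * k t)" for u v :: real
    by (rule integrableI_bounded_set[of "{u..<v}" _ _ C])
      (cases "u \<le> v"; auto intro!: AE_I2 simp: bnd)+
  have shift: "(\<integral>t. indicator {u + 2 * pi..<v + 2 * pi} t * k t \<partial>lborel) = (\<integral>t. indicator {u..<v} t * k t \<partial>lborel)" for u v
  proof -
    have "indicator {u + 2 * pi..<v + 2 * pi} (2 * pi + t) * k (2 * pi + t) = indicator {u..<v} t * k t" for t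
      using per[of t] by (auto simp: indicator_def add.commute)
    then show ?thesis
      by (subst lborel_integral_real_affine[where c = 1 and t = "2 * pi"]) auto
  qed
  have pos: "(\<integral>t. indicator {b..<b + 2 * pi} t * k t \<partial>lborel) = (\<integral>t. indicator {0..<2 * pi} t * k t \<partial>lborel)"
    if b: "0 \<le> b" "b \<le> 2 * pi" for b
  proof -
    have split1: "indicator {b..<b + 2 * pi} t = indicator {b..<2 * pi} t + (indicator {0 + 2 * pi..<b + 2 * pi} t :: real)" for t
      using b by (auto simp: indicator_def)
    have split2: "indicator {0..<2 * pi} t = indicator {0..<b} t + (indicator {b..<2 * pi} t :: real)" for t
      using b by (auto simp: indicator_def)
    have "(\<integral>t. indicator {b..<b + 2 * pi} t * k t \<partial>lborel)
        = (\<integral>t. indicator {b..<2 * pi} t * k t \<partial>lborel) + (\<integral>t. indicator {0 + 2 * pi..<b + 2 * pi} t * k t \<partial>lborel)"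
      unfolding split1 distrib_right using int by (rule Bochner_Integration.integral_add) (rule int)
    also have "\<dots> = (\<integral>t. indicator {0..<2 * pi} t * k t \<partial>lborel)"
      unfolding shift split2 distrib_right using int
      by (subst Bochner_Integration.integral_add) (auto simp: int)
    finally show ?thesis .
  qed
  show ?thesis
  proof (cases "0 \<le> a")
    case True
    then show ?thesis using pos a by simp
  next
    case False
    then show ?thesis using pos[of "a + 2 * pi"] shift[of a "a + 2 * pi"] a by simp
  qed
qed

lemma integral_periodic_reflect:
  fixes k :: "real \<Rightarrow> real"
  assumes [measurable]: "k \<in> borel_measurable borel" and bnd: "\<And>t. \<bar>k t\<bar> \<le> C"
    and per: "\<And>t. k (t + 2 * pi) = k t" and c: "- pi \<le> c" "c \<le> pi"
  shows "(\<integral>t. indicator {0..<2 * pi} t * k (c - t) \<partial>lborel) = (\<integral>t. indicator {0..<2 * pi} t * k t \<partial>lborel)"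
proof -
  have "k (c - t) = k (c + 2 * pi - t)" for t using per[of "c - t"] by (simp add: algebra_simps)
  then have "(\<integral>t. indicator {0..<2 * pi} t * k (c - t) \<partial>lborel)
      = (\<integral>t. indicator {0..<2 * pi} (c + 2 * pi - t) * k t \<partial>lborel)"
    by (subst lborel_integral_real_affine[where c = "-1" and t = "c + 2 * pi"]) auto
  also have "\<dots> = (\<integral>t. indicator {c..<c + 2 * pi} t * k t \<partial>lborel)"
  \<comment> \<open>Reflection turns the half-open interval around, so the two indicators differ at
    its end points.\<close>
  proof (rule integral_cong_AE)
    have "AE t in lborel. t \<noteq> c" "AE t in lborel. t \<noteq> c + 2 * pi"
      by (auto intro: AE_lborel_singleton)
    then show "AE t in lborel. indicator {0..<2 * pi} (c + 2 * pi - t) * k t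
        = indicator {c..<c + 2 * pi} t * k t"
      by eventually_elim (auto simp: indicator_def)
  qed measurable
  also have "\<dots> = (\<integral>t. indicator {0..<2 * pi} t * k t \<partial>lborel)"
    by (rule integral_periodic_shift[OF assms(1) bnd per]) (use c pi_gt_zero in auto)
  finally show ?thesis .
qed

lemma not_interior_of_supporting:
  assumes "norm v = 1" "\<And>s. s \<in> S \<Longrightarrow> v \<bullet> s \<le> v \<bullet> y"
  shows "y \<notin> interior (convex hull S)"
proof
  assume "y \<in> interior (convex hull S)"
  then obtain d where d: "d > 0" "cball y d \<subseteq> convex hull S" by (meson mem_interior_cball)
  have "convex hull S \<subseteq> {z. v \<bullet> z \<le> v \<bullet> y}"
    using assms(2) by (intro hull_minimal convex_halfspace_le) auto
  moreover have "y + d *\<^sub>R v \<in> convex hull S"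
    using d assms(1) by (intro subsetD[OF d(2)]) (auto simp: dist_norm)
  ultimately have "v \<bullet> (y + d *\<^sub>R v) \<le> v \<bullet> y" by blast
  then show False using d(1) assms(1) by (simp add: inner_add_right dot_square_norm)
qed

lemma admissible_of_supporting:
  assumes v: "norm v = 1" "\<And>s. s \<le> n \<Longrightarrow> v \<bullet> x s \<le> v \<bullet> x n" and "0 \<le> v \<bullet> cis \<theta>"
  shows "admissible x n \<theta>"
proof -
  have "x n + t *\<^sub>R cis \<theta> \<notin> interior (hull_upto x n)" if "0 \<le> t" for t
    unfolding hull_upto_def
  proof (rule not_interior_of_supporting[OF v(1)])
    fix y assume "y \<in> x ` {..n}"
    then have "v \<bullet> y \<le> v \<bullet> x n" using v(2) by auto
    moreover have "0 \<le> t * (v \<bullet> cis \<theta>)" using that assms(3) by simp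
    ultimately show "v \<bullet> y \<le> v \<bullet> (x n + t *\<^sub>R cis \<theta>)" by (simp add: inner_add_right)
  qed
  then show ?thesis by (auto simp: admissible_def in_segment algebra_simps)
qed

lemma not_interior_hull_supporting:
  assumes "x n \<notin> interior (hull_upto x n)"
  obtains v where "norm v = 1" "\<And>s. s \<le> n \<Longrightarrow> v \<bullet> x s \<le> v \<bullet> x n"
proof -
  obtain v where "norm v = 1" "\<And>y. y \<in> hull_upto x n \<Longrightarrow> v \<bullet> y \<le> v \<bullet> x n"
    using not_interior_supporting_direction[OF _ assms] unfolding hull_upto_def
    by (metis convex_convex_hull)
  then show thesis
    by (intro that[of v]) (auto simp: hull_upto_def hull_inc)
qed

text \<open>The inadmissible directions form the open convex cone of the interior of the hull seen from \<open>x n\<close>, and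
  \<open>- u\<close> points into its closure. Hence the cone contains the mirror image of each of its directions that
  make an acute angle with \<open>u\<close>.\<close>

lemma inadmissible_reflect:
  assumes out: "x n \<notin> interior (hull_upto x n)" and i: "i \<le> n"
    and u: "u = sgn (x n - x i)" "x n \<noteq> x i"
    and \<theta>: "0 \<le> u \<bullet> cis \<theta>" "\<not> admissible x n \<theta>"
    and refl: "cis \<theta>' = cis \<theta> - (2 * (u \<bullet> cis \<theta>)) *\<^sub>R u"
  shows "\<not> admissible x n \<theta>'"
proof -
  obtain t where t: "0 \<le> t" "t \<le> 1" "x n + t *\<^sub>R cis \<theta> \<in> interior (hull_upto x n)"
    using \<theta>(2) unfolding admissible_def by (force simp: in_segment algebra_simps)
  define R where "R = norm (x n - x i)"
  have R: "R > 0" "x n - x i = R *\<^sub>R u" using u by (auto simp: R_def sgn_div_norm)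
  define r where "r = 2 * (u \<bullet> cis \<theta>) * t / R"
  have r: "0 \<le> r" using \<theta>(1) t(1) R(1) by (simp add: r_def)
  \<comment> \<open>Reflection subtracts \<open>r\<close> times \<open>x n - x i\<close> from the
    vector pointing to the interior point. Rescaled by 1 / (1 + r), this is the convex combination
    of \<open>x i\<close>, with weight \<open>a\<close>, and the interior point; it lies on the
    reflected ray and is again interior.\<close>
  define a where "a = r / (1 + r)"
  have a: "0 \<le> a" "a < 1" "a = (1 - a) * r" using r by (auto simp: a_def field_simps)
  have int: "x i - (1 - a) *\<^sub>R (x i - (x n + t *\<^sub>R cis \<theta>)) \<in> interior (hull_upto x n)"
    by (rule mem_interior_convex_shrink[OF _ t(3)])
      (use a i in \<open>auto simp: hull_upto_def hull_inc\<close>)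
  have "x i - (1 - a) *\<^sub>R (x i - (x n + t *\<^sub>R cis \<theta>)) = x n + ((1 - a) * t) *\<^sub>R cis \<theta> - a *\<^sub>R (x n - x i)"
    by (simp add: algebra_simps)
  also have "a *\<^sub>R (x n - x i) = ((1 - a) * t * (2 * (u \<bullet> cis \<theta>))) *\<^sub>R u"
  proof -
    have "a * R = (1 - a) * t * (2 * (u \<bullet> cis \<theta>))"
      using R(1) by (subst a(3)) (simp add: r_def)
    then show ?thesis by (simp add: R(2))
  qed
  also have "x n + ((1 - a) * t) *\<^sub>R cis \<theta> - ((1 - a) * t * (2 * (u \<bullet> cis \<theta>))) *\<^sub>R u = x n + ((1 - a) * t) *\<^sub>R cis \<theta>'"
    by (simp add: refl algebra_simps)
  finally have "x n + ((1 - a) * t) *\<^sub>R cis \<theta>' \<in> interior (hull_upto x n)" using int by simp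
  moreover have "x n + b *\<^sub>R cis \<theta>' \<in> closed_segment (x n) (x n + cis \<theta>')" if "0 \<le> b" "b \<le> 1" for b
    unfolding in_segment using that by (intro exI[of _ b]) (auto simp: algebra_simps)
  moreover have "0 \<le> (1 - a) * t" "(1 - a) * t \<le> 1"
    using a t by (auto intro: mult_le_one)
  ultimately show ?thesis by (auto simp: admissible_def)
qed

text \<open>The reflection in the line orthogonal to \<open>u\<close>, in complex form. On the unit
  circle it becomes \<theta> -> c - \<theta>, where c is the argument of -u^2.\<close>

lemma reflection_eq:
  fixes u w :: complex
  assumes "norm u = 1"
  shows "- (u\<^sup>2) * cnj w = w - (2 * (u \<bullet> w)) *\<^sub>R u"
proof -
  have u2: "(Re u)\<^sup>2 + (Im u)\<^sup>2 = 1" using assms by (simp add: cmod_def)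
  have "Re w = Re w * ((Re u)\<^sup>2 + (Im u)\<^sup>2)" "Im w = Im w * ((Re u)\<^sup>2 + (Im u)\<^sup>2)" by (simp_all add: u2)
  then show ?thesis
    by (auto simp: complex_eq_iff inner_complex_def power2_eq_square algebra_simps)
qed

text \<open>Averaging the integrand with its mirror image gives (A(\<theta>) - A(c - \<theta>))
  times the outward component, with A the indicator of admissibility. Both factors change sign under
  the reflection, and by \<open>inadmissible_reflect\<close> the first is nonnegative on outward
  directions, so the product is nonnegative pointwise.\<close>

lemma integral_admissible_outward:
  assumes out: "x n \<notin> interior (hull_upto x n)" and i: "i \<le> n"
  shows "0 \<le> (\<integral>\<theta>. indicator (admissible_angles x n) \<theta> * ((x n - x i) \<bullet> cis \<theta>) \<partial>lborel)"
proof (cases "x n = x i")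
  case False
  define u where "u = sgn (x n - x i)"
  have u1: "norm u = 1" using False by (simp add: u_def norm_sgn)
  define R where "R = norm (x n - x i)"
  have R: "R > 0" "x n - x i = R *\<^sub>R u" using False by (auto simp: R_def u_def sgn_div_norm)
  define c where "c = Arg (- (u\<^sup>2))"
  have c: "- pi \<le> c" "c \<le> pi" using Arg_bounded[of "- (u\<^sup>2)"] by (auto simp: c_def)
  have "u \<noteq> 0" using u1 by auto
  then have "cis c = - (u\<^sup>2)"
    using u1 cis_Arg[of "- (u\<^sup>2)"] by (auto simp: c_def sgn_div_norm norm_power)
  then have reflect: "cis (c - \<theta>) = cis \<theta> - (2 * (u \<bullet> cis \<theta>)) *\<^sub>R u" for \<theta>
    using reflection_eq[OF u1, of "cis \<theta>"] by (simp add: cis_cnj cis_mult[symmetric] diff_conv_add_uminus del: add_uminus_conv_diff)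
  have urefl: "u \<bullet> cis (c - \<theta>) = - (u \<bullet> cis \<theta>)" for \<theta>
  proof -
    have "u \<bullet> u = 1" using u1 by (simp add: dot_square_norm)
    then show ?thesis unfolding reflect inner_diff_right inner_scaleR_right by simp
  qed
  define A where "A = (\<lambda>\<theta>. of_bool (admissible x n \<theta>) :: real)"
  have [measurable]: "Measurable.pred borel (\<lambda>\<theta>. admissible x n \<theta>)"
    by (rule pred_admissible[where f = "\<lambda>_. x"]) auto
  have [measurable]: "A \<in> borel_measurable borel" unfolding A_def by measurable
  define k where "k = (\<lambda>\<theta>. A \<theta> * (u \<bullet> cis \<theta>))"
  have k: "k \<in> borel_measurable borel" unfolding k_def by measurable
  have kb: "\<bar>k t\<bar> \<le> 1" for t
    using Cauchy_Schwarz_ineq2[of u "cis t"] u1 by (auto simp: k_def A_def)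
  have per: "k (t + 2 * pi) = k t" for t
  proof -
    have "cis (t + 2 * pi) = cis t" by (simp add: cis_mult[symmetric])
    then show ?thesis using admissible_cong[of n x x "t + 2 * pi" t] by (simp add: k_def A_def)
  qed
  have mono: "A (c - \<theta>) \<le> A \<theta>" if "0 \<le> u \<bullet> cis \<theta>" for \<theta>
    using inadmissible_reflect[OF out i u_def False that _ reflect] by (auto simp: A_def)
  have nn: "0 \<le> (A \<theta> - A (c - \<theta>)) * (u \<bullet> cis \<theta>)" for \<theta>
  proof (cases "0 \<le> u \<bullet> cis \<theta>")
    case True
    then show ?thesis using mono by simp
  next
    case False
    then have "A \<theta> \<le> A (c - \<theta>)" using mono[of "c - \<theta>"] urefl[of \<theta>] by simp
    then show ?thesis using False by (simp add: mult_nonpos_nonpos)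
  qed
  have int: "integrable lborel (\<lambda>t. indicator {0..<2 * pi} t * h t)"
    if "h \<in> borel_measurable borel" "\<And>t. \<bar>h t\<bar> \<le> 1" for h :: "real \<Rightarrow> real"
    by (rule integrableI_bounded_set[of "{0..<2 * pi}" _ _ 1])
      (use that in \<open>auto intro!: AE_I2 \<close>)
  let ?I = "\<integral>t. indicator {0..<2 * pi} t * k t \<partial>lborel"
  have "0 \<le> (\<integral>t. indicator {0..<2 * pi} t * ((A t - A (c - t)) * (u \<bullet> cis t)) \<partial>lborel)"
    by (intro Bochner_Integration.integral_nonneg mult_nonneg_nonneg nn) auto
  also have "\<dots> = (\<integral>t. indicator {0..<2 * pi} t * k t + indicator {0..<2 * pi} t * k (c - t) \<partial>lborel)"
    by (intro Bochner_Integration.integral_cong refl) (simp add: k_def urefl algebra_simps)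
  also have "\<dots> = ?I + (\<integral>t. indicator {0..<2 * pi} t * k (c - t) \<partial>lborel)"
    using k kb by (intro Bochner_Integration.integral_add int) auto
  also have "(\<integral>t. indicator {0..<2 * pi} t * k (c - t) \<partial>lborel) = ?I"
    by (rule integral_periodic_reflect[OF k kb per c])
  finally have "0 \<le> ?I" by simp
  then have "0 \<le> R * ?I" using R(1) by simp
  also have "R * ?I = (\<integral>t. R * (indicator {0..<2 * pi} t * k t) \<partial>lborel)" by simp
  also have "\<dots> = (\<integral>\<theta>. indicator (admissible_angles x n) \<theta> * ((x n - x i) \<bullet> cis \<theta>) \<partial>lborel)"
    by (intro Bochner_Integration.integral_cong refl)
      (auto simp: R(2) k_def A_def admissible_angles_def indicator_def)
  finally show ?thesis .
qed simp

section \<open>The admissible arc and the drift of one step\<close>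

text \<open>Only one half of the arc of angles within pi/3 of the normal is used, the one pointing
  towards the middle of [0, 2 pi), so that no wrap-around occurs.\<close>

lemma half_plane_arc:
  assumes "norm v = 1"
  obtains a where "{a..a + pi / 3} \<subseteq> {0..<2 * pi}" "\<And>\<theta>. \<theta> \<in> {a..a + pi / 3} \<Longrightarrow> 1 / 2 \<le> v \<bullet> cis \<theta>"
proof -
  obtain \<phi> where \<phi>: "0 \<le> \<phi>" "\<phi> < 2 * pi" "v = cis \<phi>"
  proof -
    have "v \<noteq> 0" using assms by auto
    then have v: "v = cis (Arg v)" "v = cis (Arg v + 2 * pi)"
      using cis_Arg[of v] assms by (simp_all add: sgn_div_norm cis_mult[symmetric])
    show thesis
    proof (cases "0 \<le> Arg v")
      case True
      then show thesis using that[of "Arg v"] v Arg_bounded[of v] by auto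
    next
      case False
      then show thesis using that[of "Arg v + 2 * pi"] v Arg_bounded[of v] by auto
    qed
  qed
  have near: "1 / 2 \<le> v \<bullet> cis \<theta>" if "\<bar>\<theta> - \<phi>\<bar> \<le> pi / 3" for \<theta>
  proof -
    have "1 / 2 = cos (pi / 3)" by (simp add: cos_60)
    also have "\<dots> \<le> cos \<bar>\<theta> - \<phi>\<bar>" using that by (intro cos_monotone_0_pi_le) auto
    also have "\<dots> = v \<bullet> cis \<theta>" by (simp add: \<phi>(3) inner_complex_def cos_diff mult.commute)
    finally show ?thesis .
  qed
  show thesis
  proof (cases "\<phi> < pi")
    case True
    then show thesis using \<phi> by (intro that[of \<phi>] near) auto
  next
    case False
    then show thesis using \<phi> pi_gt_zero by (intro that[of "\<phi> - pi / 3"] near) auto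
  qed
qed

lemma measure_admissible_angles:
  assumes "x n \<notin> interior (hull_upto x n)"
  shows "pi / 3 \<le> measure lborel (admissible_angles x n)"
    "measure lborel (admissible_angles x n) \<le> 2 * pi"
    "0 < measure lborel (admissible_angles x n)"
    "emeasure lborel (admissible_angles x n) = ennreal (measure lborel (admissible_angles x n))"
proof -
  have sub: "admissible_angles x n \<subseteq> {0..<2 * pi}" by (auto simp: admissible_angles_def)
  have "emeasure lborel (admissible_angles x n) \<le> emeasure lborel {0..<2 * pi}"
    by (intro emeasure_mono sub) auto
  also have "\<dots> < \<infinity>" by simp
  finally have fin: "admissible_angles x n \<in> fmeasurable lborel" by (simp add: fmeasurable_def)
  then show "emeasure lborel (admissible_angles x n) = ennreal (measure lborel (admissible_angles x n))"
    by (rule emeasure_eq_measure2)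
  have "measure lborel (admissible_angles x n) \<le> measure lborel {0..<2 * pi}"
    by (intro measure_mono_fmeasurable sub) (auto simp: fmeasurable_def)
  then show "measure lborel (admissible_angles x n) \<le> 2 * pi" by simp
  obtain v where v: "norm v = 1" "\<And>s. s \<le> n \<Longrightarrow> v \<bullet> x s \<le> v \<bullet> x n"
    using not_interior_hull_supporting[of x n, OF assms] by blast
  obtain a where a: "{a..a + pi / 3} \<subseteq> {0..<2 * pi}" "\<And>\<theta>. \<theta> \<in> {a..a + pi / 3} \<Longrightarrow> 1 / 2 \<le> v \<bullet> cis \<theta>"
    using half_plane_arc[OF v(1)] by blast
  have "{a..a + pi / 3} \<subseteq> admissible_angles x n"
    using a admissible_of_supporting[of v n x, OF v] unfolding admissible_angles_def by force
  then have "measure lborel {a..a + pi / 3} \<le> measure lborel (admissible_angles x n)"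
    by (intro measure_mono_fmeasurable fin) auto
  then show ge: "pi / 3 \<le> measure lborel (admissible_angles x n)" by simp
  then show "0 < measure lborel (admissible_angles x n)" using pi_gt_zero by linarith
qed

text \<open>The law of the angle rather than of the new position: all one-step estimates become
  integrals over the real line.\<close>

definition step_law :: "(nat \<Rightarrow> complex) \<Rightarrow> nat \<Rightarrow> real measure" where
  "step_law x n = uniform_measure lborel (admissible_angles x n)"

lemma sets_step_law [simp, measurable_cong]: "sets (step_law x n) = sets borel"
  by (simp add: step_law_def)

lemma space_step_law [simp]: "space (step_law x n) = UNIV"
  by (simp add: step_law_def)

lemma prob_space_step_law:
  assumes "x n \<notin> interior (hull_upto x n)"
  shows "prob_space (step_law x n)"
  unfolding step_law_def
  by (rule prob_space_uniform_measure) (use measure_admissible_angles[of x n, OF assms] in \<open>auto simp: ennreal_eq_0_iff\<close>)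

lemma integral_step_law:
  assumes "x n \<notin> interior (hull_upto x n)" and [measurable]: "f \<in> borel_measurable borel"
  shows "(\<integral>\<theta>. f \<theta> \<partial>step_law x n)
    = (\<integral>\<theta>. indicator (admissible_angles x n) \<theta> * f \<theta> \<partial>lborel) / measure lborel (admissible_angles x n)"
proof -
  let ?A = "admissible_angles x n"
  have inv: "1 / ennreal c = ennreal (1 / c)" if "0 < c" for c
    using divide_ennreal[of 1 c] that by simp
  have "step_law x n = density lborel (\<lambda>\<theta>. ennreal (indicator ?A \<theta> / measure lborel ?A))"
    unfolding step_law_def uniform_measure_def
    using inv[OF measure_admissible_angles(3)[of x n, OF assms(1)]] measure_admissible_angles(4)[of x n, OF assms(1)]
    by (intro density_cong AE_I2) (auto simp: indicator_def)
  then have "(\<integral>\<theta>. f \<theta> \<partial>step_law x n) = (\<integral>\<theta>. (indicator ?A \<theta> / measure lborel ?A) *\<^sub>R f \<theta> \<partial>lborel)"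
    by (simp only:) (rule integral_density, auto)
  then show ?thesis by simp
qed

lemma integrable_step_law:
  assumes "x n \<notin> interior (hull_upto x n)" "f \<in> borel_measurable borel" "\<And>\<theta>. \<bar>f \<theta>\<bar> \<le> (C::real)"
  shows "integrable (step_law x n) f"
proof -
  interpret prob_space "step_law x n" by (rule prob_space_step_law) fact
  show ?thesis by (rule integrable_const_bound[where B = C]) (use assms in auto)
qed

text \<open>By Cauchy-Schwarz the norm lies above its linearisation at d = x n - x i, and the linear
  term has nonnegative mean. For d = 0 the quotient below is 0 by convention and the bound is
  trivial.\<close>

lemma expectation_dist_increment:
  assumes out: "x n \<notin> interior (hull_upto x n)" and i: "i \<le> n"
  shows "0 \<le> (\<integral>\<theta>. dist (x n + cis \<theta>) (x i) - dist (x n) (x i) \<partial>step_law x n)"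
proof -
  define d where "d = x n - x i"
  have "0 \<le> (\<integral>\<theta>. d \<bullet> cis \<theta> \<partial>step_law x n) / norm d"
    using integral_admissible_outward[OF out i] measure_admissible_angles[of x n, OF out]
    by (subst integral_step_law[OF out]) (auto simp: d_def)
  also have "\<dots> = (\<integral>\<theta>. d \<bullet> cis \<theta> / norm d \<partial>step_law x n)" by simp
  also have "\<dots> \<le> (\<integral>\<theta>. dist (x n + cis \<theta>) (x i) - dist (x n) (x i) \<partial>step_law x n)"
  proof (rule integral_mono)
    show "integrable (step_law x n) (\<lambda>\<theta>. d \<bullet> cis \<theta> / norm d)"
    proof (rule integrable_step_law[OF out])
      show "\<bar>d \<bullet> cis \<theta> / norm d\<bar> \<le> 1" for \<theta>
        using Cauchy_Schwarz_ineq2[of d "cis \<theta>"] by (simp add: divide_le_eq)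
    qed measurable
    show "integrable (step_law x n) (\<lambda>\<theta>. dist (x n + cis \<theta>) (x i) - dist (x n) (x i))"
    proof (rule integrable_step_law[OF out])
      show "\<bar>dist (x n + cis \<theta>) (x i) - dist (x n) (x i)\<bar> \<le> 1" for \<theta>
        using dist_triangle[of "x n + cis \<theta>" "x i" "x n"] dist_triangle[of "x n" "x i" "x n + cis \<theta>"]
        by (simp add: abs_le_iff dist_norm)
    qed measurable
    fix \<theta>
    have "d \<bullet> (d + cis \<theta>) \<le> norm d * norm (d + cis \<theta>)" by (rule norm_cauchy_schwarz)
    then have "d \<bullet> cis \<theta> / norm d \<le> norm (d + cis \<theta>) - norm d"
      by (cases "d = 0") (auto simp: inner_add_right field_simps power2_norm_eq_inner power2_eq_square dot_square_norm)
    then show "d \<bullet> cis \<theta> / norm d \<le> dist (x n + cis \<theta>) (x i) - dist (x n) (x i)"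
      by (simp add: d_def dist_norm algebra_simps)
  qed
  finally show ?thesis .
qed

text \<open>On the arc of length pi/3 the component along \<open>v\<close> is at least 1/2, hence
  the one along \<open>e\<close> at least 3/8, which exceeds 1/4 by 1/8. The density is at least 1 /
  (2 pi), and (1/8) (pi/3) / (2 pi) = 1/48.\<close>

lemma expectation_exceed_ge:
  assumes out: "x n \<notin> interior (hull_upto x n)" and v: "norm v = 1" "\<And>s. s \<le> n \<Longrightarrow> v \<bullet> x s \<le> v \<bullet> x n"
    and e: "norm (e - v) \<le> 1 / 8" "norm e = 1"
  shows "1 / 48 \<le> (\<integral>\<theta>. max 0 (e \<bullet> cis \<theta> - 1 / 4) \<partial>step_law x n)"
proof -
  obtain a where a: "{a..a + pi / 3} \<subseteq> {0..<2 * pi}" "\<And>\<theta>. \<theta> \<in> {a..a + pi / 3} \<Longrightarrow> 1 / 2 \<le> v \<bullet> cis \<theta>"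
    using half_plane_arc[OF v(1)] by blast
  let ?J = "{a..a + pi / 3}" and ?A = "admissible_angles x n"
  have JA: "?J \<subseteq> ?A"
    using a admissible_of_supporting[of v n x, OF v] unfolding admissible_angles_def by force
  have e8: "1 / 8 \<le> e \<bullet> cis \<theta> - 1 / 4" if "\<theta> \<in> ?J" for \<theta>
  proof -
    have "e \<bullet> cis \<theta> = v \<bullet> cis \<theta> + (e - v) \<bullet> cis \<theta>" by (simp add: inner_diff_left)
    moreover have "\<bar>(e - v) \<bullet> cis \<theta>\<bar> \<le> 1 / 8"
      using Cauchy_Schwarz_ineq2[of "e - v" "cis \<theta>"] e(1) by simp
    ultimately show ?thesis using a(2)[OF that] by linarith
  qed
  have "(1 / 48) \<le> (1 / 8) * (pi / 3) / c" if "0 < c" "c \<le> 2 * pi" for c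
    using that by (simp add: field_simps)
  from this[OF measure_admissible_angles(3,2)[of x n, OF out]]
  have "(1 / 48) \<le> (1 / 8) * (pi / 3) / measure lborel ?A" .
  moreover have "(1 / 8) * (pi / 3) = (\<integral>\<theta>. indicator ?J \<theta> * (1 / 8) \<partial>lborel)" by simp
  moreover have "(\<integral>\<theta>. indicator ?J \<theta> * (1 / 8) \<partial>lborel)
      \<le> (\<integral>\<theta>. indicator ?A \<theta> * max 0 (e \<bullet> cis \<theta> - 1 / 4) \<partial>lborel)"
  proof (rule integral_mono)
    show "integrable lborel (\<lambda>\<theta>. indicator ?J \<theta> * (1 / 8 :: real))"
      by (rule integrableI_bounded_set[of ?J _ _ 1]) auto
    have "e \<bullet> cis \<theta> \<le> 1" for \<theta> using norm_cauchy_schwarz[of e "cis \<theta>"] e(2) by simp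
    then have "\<bar>max 0 (e \<bullet> cis \<theta> - 1 / 4)\<bar> \<le> 1" for \<theta>
      by (smt (verit, best) divide_nonneg_nonneg)
    then show "integrable lborel (\<lambda>\<theta>. indicator ?A \<theta> * max 0 (e \<bullet> cis \<theta> - 1 / 4))"
      using measure_admissible_angles(4)[of x n, OF out]
      by (intro integrableI_bounded_set[of ?A _ _ 1]) auto
    show "indicator ?J \<theta> * (1 / 8) \<le> indicator ?A \<theta> * max 0 (e \<bullet> cis \<theta> - 1 / 4)" for \<theta>
      using e8[of \<theta>] JA by (auto simp: indicator_def)
  qed
  ultimately have "1 / 48 \<le> (\<integral>\<theta>. indicator ?A \<theta> * max 0 (e \<bullet> cis \<theta> - 1 / 4) \<partial>lborel) / measure lborel ?A"
    by (metis (no_types, lifting) divide_right_mono measure_nonneg order_trans)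
  then show ?thesis
    by (subst integral_step_law[OF out]) simp_all
qed

section \<open>Exponential moments of one step\<close>

lemma exp_minus_le_quadratic:
  fixes y :: real
  assumes "\<bar>y\<bar> \<le> 1"
  shows "exp (- y) \<le> 1 - y + y\<^sup>2"
proof (cases "0 \<le> y")
  case True
  have "exp (- y) = inverse (exp y)" by (simp add: exp_minus)
  also have "\<dots> \<le> inverse (1 + y)" using True by (intro le_imp_inverse_le) auto
  also have "\<dots> \<le> 1 - y + y\<^sup>2"
  proof -
    have "(1 - y + y\<^sup>2) * (1 + y) = 1 + y ^ 3" by (simp add: power2_eq_square power3_eq_cube algebra_simps)
    then show ?thesis using True by (simp add: inverse_eq_divide divide_le_eq)
  qed
  finally show ?thesis .
next
  case False
  then show ?thesis using exp_bound[of "- y"] assms by simp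
qed

text \<open>Second-order expansion of the exponential: the drift enters linearly, and the quadratic
  term is controlled by the bound on \<open>f\<close> in place of its variance.\<close>

lemma (in prob_space) nn_integral_exp_minus_le:
  fixes f :: "'a \<Rightarrow> real"
  assumes [measurable]: "f \<in> borel_measurable M" and f: "\<And>\<omega>. \<bar>f \<omega>\<bar> \<le> b" and l: "0 \<le> l" "l * b \<le> 1"
    and d: "d \<le> expectation f"
  shows "(\<integral>\<^sup>+\<omega>. ennreal (exp (- l * f \<omega>)) \<partial>M) \<le> ennreal (exp (- l * d + l\<^sup>2 * b\<^sup>2))"
proof -
  have lf: "\<bar>l * f \<omega>\<bar> \<le> l * b" for \<omega> using f[of \<omega>] l(1) by (simp add: abs_mult mult_left_mono)
  have int: "integrable M f" using f by (intro integrable_const_bound[where B = b]) auto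
  have "exp (- l * f \<omega>) \<le> 1 - l * f \<omega> + l\<^sup>2 * b\<^sup>2" for \<omega>
  proof -
    have "(l * f \<omega>)\<^sup>2 \<le> (l * b)\<^sup>2" using power_mono[OF lf[of \<omega>], of 2] by simp
    then show ?thesis
      using exp_minus_le_quadratic[of "l * f \<omega>"] lf[of \<omega>] l(2) by (simp add: power_mult_distrib)
  qed
  then have "(\<integral>\<^sup>+\<omega>. ennreal (exp (- l * f \<omega>)) \<partial>M) \<le> (\<integral>\<^sup>+\<omega>. ennreal (1 - l * f \<omega> + l\<^sup>2 * b\<^sup>2) \<partial>M)"
    by (intro nn_integral_mono ennreal_leI)
  also have "\<dots> = ennreal (\<integral>\<omega>. 1 - l * f \<omega> + l\<^sup>2 * b\<^sup>2 \<partial>M)"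
  proof (rule nn_integral_eq_integral)
    show "AE \<omega> in M. 0 \<le> 1 - l * f \<omega> + l\<^sup>2 * b\<^sup>2"
      using lf l(2) by (intro AE_I2) (smt (verit) zero_le_mult_iff zero_le_power2)
  qed (use int in auto)
  also have "(\<integral>\<omega>. 1 - l * f \<omega> + l\<^sup>2 * b\<^sup>2 \<partial>M) = 1 - l * expectation f + l\<^sup>2 * b\<^sup>2"
    using int by (simp add: prob_space)
  also have "\<dots> \<le> 1 + (- l * d + l\<^sup>2 * b\<^sup>2)" using mult_left_mono[OF d l(1)] by simp
  also have "\<dots> \<le> exp (- l * d + l\<^sup>2 * b\<^sup>2)" by (rule exp_ge_add_one_self)
  finally show ?thesis by (simp add: ennreal_leI)
qed

lemma ennreal_double_sum_mult:
  assumes "\<And>s i. 0 \<le> c s i" "\<And>s i. 0 \<le> g s i"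
  shows "ennreal (\<Sum>s\<in>S. \<Sum>i\<in>T s. c s i * g s i) = (\<Sum>s\<in>S. \<Sum>i\<in>T s. ennreal (c s i) * ennreal (g s i))"
proof -
  have nn: "0 \<le> c s i * g s i" for s i by (intro mult_nonneg_nonneg assms)
  have "ennreal (\<Sum>s\<in>S. \<Sum>i\<in>T s. c s i * g s i) = (\<Sum>s\<in>S. ennreal (\<Sum>i\<in>T s. c s i * g s i))"
    by (rule sum_ennreal[symmetric]) (intro sum_nonneg nn)
  also have "\<dots> = (\<Sum>s\<in>S. \<Sum>i\<in>T s. ennreal (c s i * g s i))"
    by (intro sum.cong refl sum_ennreal[symmetric] nn)
  also have "\<dots> = (\<Sum>s\<in>S. \<Sum>i\<in>T s. ennreal (c s i) * ennreal (g s i))"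
    by (intro sum.cong refl ennreal_mult assms)
  finally show ?thesis .
qed

text \<open>For an existing term the submartingale contributes at most a factor exp (\<mu>^2) and
  the damping a factor exp (-2 \<mu>^2), which leaves a genuine contraction. The hypothesis
  \<open>a_upd\<close> says that the weights are fixed by the past and may be taken out of the
  integral.\<close>

lemma return_sum_step:
  assumes out: "x n \<notin> interior (hull_upto x n)" and \<mu>: "0 \<le> \<mu>" "\<mu> \<le> 1"
    and nn: "\<And>x s i. 0 \<le> a x s i" and J: "\<And>x s. (\<Sum>i\<le>s. a x s i) \<le> J"
    and a_upd: "\<And>y s i. s \<le> n \<Longrightarrow> a (x(Suc n := y)) s i = a x s i"
  shows "(\<integral>\<^sup>+\<theta>. ennreal (return_sum a \<mu> (Suc n) (x(Suc n := x n + cis \<theta>))) \<partial>step_law x n)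
    \<le> ennreal (exp (- \<mu>\<^sup>2) * return_sum a \<mu> n x + J)"
proof -
  interpret prob_space "step_law x n" by (rule prob_space_step_law) (rule out)
  define c where "c s i = a x s i * exp (\<mu> * (dist (x s) (x i) - dist (x n) (x i)) - 2 * \<mu>\<^sup>2 * real (n - s)) * exp (- 2 * \<mu>\<^sup>2)" for s i
  define D where "D i \<theta> = dist (x n + cis \<theta>) (x i) - dist (x n) (x i)" for i \<theta>
  have D_meas [measurable]: "D i \<in> borel_measurable borel" for i unfolding D_def by measurable
  have c_nn: "0 \<le> c s i" for s i by (simp add: c_def nn)
  have "0 \<le> (\<Sum>i\<le>0. a x 0 i)" by (intro sum_nonneg nn)
  then have J0: "0 \<le> J" using J[where x = x and s = 0] by linarith
  have pw: "return_sum a \<mu> (Suc n) (x(Suc n := x n + cis \<theta>)) \<le> (\<Sum>s\<le>n. \<Sum>i\<le>s. c s i * exp (- \<mu> * D i \<theta>)) + J" for \<theta>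
  proof -
    let ?x = "x(Suc n := x n + cis \<theta>)"
    have "a ?x s i * exp (\<mu> * (dist (?x s) (?x i) - dist (?x (Suc n)) (?x i)) - 2 * \<mu>\<^sup>2 * real (Suc n - s))
        = c s i * exp (- \<mu> * D i \<theta>)" if "s \<le> n" "i \<le> s" for s i
    proof -
      have e: "exp (\<mu> * (p - q) - 2 * \<mu>\<^sup>2 * (1 + t)) = exp (\<mu> * (p - dist (x n) (x i)) - 2 * \<mu>\<^sup>2 * t) * exp (- 2 * \<mu>\<^sup>2) * exp (- \<mu> * (q - dist (x n) (x i)))" for p q t
        unfolding exp_add[symmetric] by (simp add: algebra_simps)
      have "real (Suc n - s) = 1 + real (n - s)" using that by (simp add: Suc_diff_le)
      moreover have "?x s = x s" "?x i = x i" "?x (Suc n) = x n + cis \<theta>" using that by auto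
      ultimately show ?thesis
        unfolding a_upd[OF that(1)] c_def D_def by (simp only: e mult.assoc[symmetric])
    qed
    then have "(\<Sum>s\<le>n. \<Sum>i\<le>s. a ?x s i * exp (\<mu> * (dist (?x s) (?x i) - dist (?x (Suc n)) (?x i)) - 2 * \<mu>\<^sup>2 * real (Suc n - s)))
        = (\<Sum>s\<le>n. \<Sum>i\<le>s. c s i * exp (- \<mu> * D i \<theta>))"
      by (intro sum.cong refl) auto
    \<comment> \<open>The terms started at the new time have exponent 0 and contribute just their
      weights.\<close>
    moreover have "(\<Sum>i\<le>Suc n. a ?x (Suc n) i * exp (\<mu> * (dist (?x (Suc n)) (?x i) - dist (?x (Suc n)) (?x i)) - 2 * \<mu>\<^sup>2 * real (Suc n - Suc n))) \<le> J"
      using J[where x = ?x and s = "Suc n"] by (simp del: sum.atMost_Suc)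
    ultimately show ?thesis unfolding return_sum_def by (subst sum.atMost_Suc) (rule add_mono, simp_all only: order_refl)
  qed
  have "(\<integral>\<^sup>+\<theta>. ennreal (return_sum a \<mu> (Suc n) (x(Suc n := x n + cis \<theta>))) \<partial>step_law x n)
      \<le> (\<integral>\<^sup>+\<theta>. (\<Sum>s\<le>n. \<Sum>i\<le>s. ennreal (c s i) * ennreal (exp (- \<mu> * D i \<theta>))) + ennreal J \<partial>step_law x n)"
  proof (rule nn_integral_mono)
    fix \<theta>
    have "ennreal (return_sum a \<mu> (Suc n) (x(Suc n := x n + cis \<theta>)))
        \<le> ennreal ((\<Sum>s\<le>n. \<Sum>i\<le>s. c s i * exp (- \<mu> * D i \<theta>)) + J)"
      by (rule ennreal_leI[OF pw])
    also have "\<dots> = (\<Sum>s\<le>n. \<Sum>i\<le>s. ennreal (c s i) * ennreal (exp (- \<mu> * D i \<theta>))) + ennreal J"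
      by (subst ennreal_plus) (auto intro!: sum_nonneg mult_nonneg_nonneg c_nn J0 simp only: ennreal_double_sum_mult c_nn exp_ge_zero)
    finally show "ennreal (return_sum a \<mu> (Suc n) (x(Suc n := x n + cis \<theta>)))
        \<le> (\<Sum>s\<le>n. \<Sum>i\<le>s. ennreal (c s i) * ennreal (exp (- \<mu> * D i \<theta>))) + ennreal J" .
  qed
  also have "\<dots> = (\<Sum>s\<le>n. \<Sum>i\<le>s. ennreal (c s i) * (\<integral>\<^sup>+\<theta>. ennreal (exp (- \<mu> * D i \<theta>)) \<partial>step_law x n)) + ennreal J"
  proof -
    have "emeasure (step_law x n) UNIV = 1" using emeasure_space_1 by simp
    then show ?thesis by (subst nn_integral_add) (auto simp: nn_integral_sum nn_integral_cmult)
  qed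
  also have "\<dots> \<le> (\<Sum>s\<le>n. \<Sum>i\<le>s. ennreal (c s i) * ennreal (exp (\<mu>\<^sup>2))) + ennreal J"
  proof (intro add_right_mono sum_mono mult_left_mono)
    fix s i assume si: "s \<in> {..n}" "i \<in> {..s}"
    have "(\<integral>\<^sup>+\<theta>. ennreal (exp (- \<mu> * D i \<theta>)) \<partial>step_law x n) \<le> ennreal (exp (- \<mu> * 0 + \<mu>\<^sup>2 * 1\<^sup>2))"
    proof (rule nn_integral_exp_minus_le)
      show "\<bar>D i \<theta>\<bar> \<le> 1" for \<theta>
        using dist_triangle[of "x n + cis \<theta>" "x i" "x n"] dist_triangle[of "x n" "x i" "x n + cis \<theta>"]
        by (simp add: D_def abs_le_iff dist_norm)
      show "0 \<le> expectation (D i)" unfolding D_def using si by (intro expectation_dist_increment out) auto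
    qed (use \<mu> in auto)
    then show "(\<integral>\<^sup>+\<theta>. ennreal (exp (- \<mu> * D i \<theta>)) \<partial>step_law x n) \<le> ennreal (exp (\<mu>\<^sup>2))" by simp
  qed auto
  also have "\<dots> = ennreal ((\<Sum>s\<le>n. \<Sum>i\<le>s. c s i * exp (\<mu>\<^sup>2)) + J)"
    by (subst ennreal_plus) (auto intro!: sum_nonneg mult_nonneg_nonneg c_nn J0 simp only: ennreal_double_sum_mult c_nn exp_ge_zero)
  also have "(\<Sum>s\<le>n. \<Sum>i\<le>s. c s i * exp (\<mu>\<^sup>2)) = exp (- \<mu>\<^sup>2) * return_sum a \<mu> n x"
  proof -
    have "exp (- 2 * \<mu>\<^sup>2) * exp (\<mu>\<^sup>2) = exp (- \<mu>\<^sup>2)" by (simp add: exp_add[symmetric])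
    then have "c s i * exp (\<mu>\<^sup>2) = exp (- \<mu>\<^sup>2) * (a x s i * exp (\<mu> * (dist (x s) (x i) - dist (x n) (x i)) - 2 * \<mu>\<^sup>2 * real (n - s)))" for s i
      unfolding c_def by (simp only: mult.assoc) (simp only: mult_ac)
    then show ?thesis by (simp add: return_sum_def sum_distrib_left)
  qed
  finally show ?thesis .
qed

definition pen_sum :: "real \<Rightarrow> nat \<Rightarrow> nat \<Rightarrow> (nat \<Rightarrow> complex) \<Rightarrow> real" where
  "pen_sum \<delta> m n x = (\<Sum>j<m. pen_support \<delta> (grid m j) x n)"

lemma pen_support_upd: "n < k \<Longrightarrow> pen_support \<delta> e (x(k := y)) n = pen_support \<delta> e x n"
  by (induction n) auto

lemma pen_support_ge: "e \<bullet> x n \<le> pen_support \<delta> e x n"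
  by (cases n) auto

text \<open>The discount costs at most m \<delta> = 1/192 per step. If the threshold is not reached,
  an uncovered direction gains 1/48 on average, and 1/48 - 1/192 = 1/64; otherwise only the loss is
  used, and 1/64 - 1/48 = -1/192. Both cases are expressed by 1/64 - B/48.\<close>

lemma pen_sum_step:
  assumes out: "x n \<notin> interior (hull_upto x n)"
    and m: "m \<ge> 128" and \<delta>: "\<delta> = 1 / (192 * real m)" and \<mu>: "\<mu> = 1 / (1536 * pi)"
    and l: "0 \<le> l" "l * real m \<le> 1"
    and B: "B = of_bool (exp (\<mu> * real m / (16 * pi)) \<le> return_sum (far_count m) \<mu> n x)"
  shows "(\<integral>\<^sup>+\<theta>. ennreal (exp (- l * (pen_sum \<delta> m (Suc n) (x(Suc n := x n + cis \<theta>)) - pen_sum \<delta> m n x))) \<partial>step_law x n)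
    \<le> ennreal (exp (- l * (1 / 64 - B / 48) + l\<^sup>2 * (real m)\<^sup>2))"
proof -
  interpret prob_space "step_law x n" by (rule prob_space_step_law) (rule out)
  define g where "g j \<theta> = max (- \<delta>) (grid m j \<bullet> (x n + cis \<theta>) - pen_support \<delta> (grid m j) x n)" for j \<theta>
  define f where "f \<theta> = (\<Sum>j<m. g j \<theta>)" for \<theta>
  have eq: "pen_sum \<delta> m (Suc n) (x(Suc n := x n + cis \<theta>)) - pen_sum \<delta> m n x = f \<theta>" for \<theta>
    unfolding pen_sum_def f_def sum_subtractf[symmetric]
    by (intro sum.cong refl) (simp add: pen_support_upd g_def max_def algebra_simps)
  have \<delta>01: "0 \<le> \<delta>" "\<delta> \<le> 1" using m by (auto simp: \<delta> field_simps)
  have gb: "\<bar>g j \<theta>\<bar> \<le> 1" for j \<theta>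
  proof -
    have "grid m j \<bullet> cis \<theta> \<le> 1" using norm_cauchy_schwarz[of "grid m j" "cis \<theta>"] by simp
    then have "grid m j \<bullet> (x n + cis \<theta>) - pen_support \<delta> (grid m j) x n \<le> 1"
      using pen_support_ge[of "grid m j" x n \<delta>] by (simp add: inner_add_right)
    then show ?thesis using \<delta>01 by (auto simp: g_def)
  qed
  have fb: "\<bar>f \<theta>\<bar> \<le> real m" for \<theta>
    unfolding f_def using sum_mono[of "{..<m}" "\<lambda>j. \<bar>g j \<theta>\<bar>" "\<lambda>_. 1"] gb
    by (intro order_trans[OF sum_abs]) auto
  have [measurable]: "g j \<in> borel_measurable borel" for j unfolding g_def by measurable
  have [measurable]: "f \<in> borel_measurable borel" unfolding f_def by measurable
  have intf: "integrable (step_law x n) f" by (rule integrable_step_law[OF out _ fb]) measurable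
  have m\<delta>: "real m * \<delta> = 1 / 192" using m by (simp add: \<delta>)
  have "1 / 64 - B / 48 \<le> expectation f"
  proof (cases "exp (\<mu> * real m / (16 * pi)) \<le> return_sum (far_count m) \<mu> n x")
    case True
    have "- (1 / 192) \<le> f \<theta>" for \<theta>
      unfolding f_def using sum_mono[of "{..<m}" "\<lambda>j. - \<delta>" "\<lambda>j. g j \<theta>"] m\<delta> by (auto simp: g_def)
    then have "- (1 / 192) \<le> expectation f"
      using integral_ge_const[OF intf] by (auto simp: intf)
    then show ?thesis using True by (simp add: B)
  next
    case False
    obtain v where v: "norm v = 1" "\<And>s. s \<le> n \<Longrightarrow> v \<bullet> x s \<le> v \<bullet> x n"
      using not_interior_hull_supporting[of x n, OF out] by blast
    have \<mu>': "\<mu> = \<delta> * real m / (8 * pi)" using m by (simp add: \<mu> \<delta>)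
    obtain j where j: "j < m" "norm (grid m j - v) \<le> 2 * pi / real m"
      "pen_support \<delta> (grid m j) x n - 1 / 4 \<le> grid m j \<bullet> x n"
      using exists_uncovered_direction[of m v n x, OF m v \<delta>01(1) \<mu>'] False by (auto simp: not_le)
    have "2 * pi / real m \<le> 1 / 8" using m pi_less_4 by (simp add: field_simps)
    then have j8: "norm (grid m j - v) \<le> 1 / 8" using j(2) by simp
    define h where "h \<theta> = max 0 (grid m j \<bullet> cis \<theta> - 1 / 4)" for \<theta>
    have hb: "\<bar>h \<theta>\<bar> \<le> 1" for \<theta>
      using norm_cauchy_schwarz[of "grid m j" "cis \<theta>"] by (auto simp: h_def)
    have [measurable]: "h \<in> borel_measurable borel" unfolding h_def by measurable
    have inth: "integrable (step_law x n) h" by (rule integrable_step_law[OF out _ hb]) measurable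
    have "h \<theta> - 1 / 192 \<le> f \<theta>" for \<theta>
    proof -
      \<comment> \<open>When \<open>h\<close> is positive, \<open>g j\<close> is at least
        \<open>h\<close>, because the current position is short of the support function by at most
        1/4. The discount is subtracted here as well, so that all \<open>m\<close> directions lose
        the same amount.\<close>
      have "h \<theta> - \<delta> \<le> g j \<theta>" using j(3) \<delta>01 by (auto simp: h_def g_def inner_add_right max_def)
      moreover have "(\<Sum>k\<in>{..<m} - {j}. - \<delta>) \<le> (\<Sum>k\<in>{..<m} - {j}. g k \<theta>)"
        by (intro sum_mono) (auto simp: g_def)
      moreover have "f \<theta> = g j \<theta> + (\<Sum>k\<in>{..<m} - {j}. g k \<theta>)"
        unfolding f_def using j(1) by (intro sum.remove) auto
      moreover have "(\<Sum>k\<in>{..<m} - {j}. - \<delta>) = \<delta> - 1 / 192"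
        using j(1) m\<delta> by (simp add: of_nat_diff algebra_simps)
      ultimately show ?thesis by linarith
    qed
    then have "expectation (\<lambda>\<theta>. h \<theta> - 1 / 192) \<le> expectation f"
      using intf inth by (intro integral_mono) auto
    moreover have "1 / 48 \<le> expectation h"
      unfolding h_def by (rule expectation_exceed_ge[of x n v, OF out v j8]) auto
    moreover have "prob UNIV = 1" using prob_space by simp
    ultimately show ?thesis using False inth by (simp add: B)
  qed
  then show ?thesis
    unfolding eq by (intro nn_integral_exp_minus_le fb l) auto
qed

section \<open>Transition from one step to the walk\<close>

definition hist :: "(nat \<Rightarrow> 'a \<Rightarrow> complex) \<Rightarrow> nat \<Rightarrow> 'a \<Rightarrow> nat \<Rightarrow> complex" where
  "hist X n \<omega> = (\<lambda>k\<in>{..n}. X k \<omega>)"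

lemma hist_apply [simp]: "k \<le> n \<Longrightarrow> hist X n \<omega> k = X k \<omega>"
  by (simp add: hist_def)

lemma hist_Suc: "hist X (Suc n) \<omega> = (hist X n \<omega>)(Suc n := X (Suc n) \<omega>)"
  by (auto simp: hist_def fun_eq_iff restrict_def)

lemma admissible_angles_cong:
  "(\<And>k. k \<le> n \<Longrightarrow> x k = y k) \<Longrightarrow> admissible_angles x n = admissible_angles y n"
  using admissible_cong[of n x y] by (auto simp: admissible_angles_def)

lemma step_law_cong:
  "(\<And>k. k \<le> n \<Longrightarrow> x k = y k) \<Longrightarrow> step_law x n = step_law y n"
  by (simp add: step_law_def admissible_angles_cong[of n x y])

text \<open>Stated for arbitrary paths: that the walk avoids the interior of its hull is proved only
  later, through the kernel formula that rests on this identity.\<close>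

lemma emeasure_step_law:
  assumes [measurable]: "B \<in> sets borel"
  shows "emeasure (step_law x n) {\<theta>. x n + cis \<theta> \<in> B} = ennreal (step_prob x n B)"
proof -
  let ?A = "admissible_angles x n"
  have sub: "?A \<subseteq> {0..<2 * pi}" by (auto simp: admissible_angles_def)
  have fin: "emeasure lborel C = ennreal (measure lborel C)" if "C \<subseteq> ?A" "C \<in> sets borel" for C
  proof -
    have "emeasure lborel C \<le> emeasure lborel {0..<2 * pi}" using that sub by (intro emeasure_mono) auto
    also have "\<dots> < \<infinity>" by simp
    finally show ?thesis by (intro emeasure_eq_ennreal_measure) auto
  qed
  have eq: "?A \<inter> {\<theta>. x n + cis \<theta> \<in> B} = {\<theta> \<in> ?A. x n + cis \<theta> \<in> B}" by auto
  have [measurable]: "{\<theta>. x n + cis \<theta> \<in> B} \<in> sets borel"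
    using measurable_sets_borel[of "\<lambda>\<theta>. x n + cis \<theta>" borel B] by (simp add: vimage_def)
  have [measurable]: "{\<theta> \<in> ?A. x n + cis \<theta> \<in> B} \<in> sets borel" unfolding eq[symmetric] by measurable
  have "emeasure (step_law x n) {\<theta>. x n + cis \<theta> \<in> B}
      = ennreal (measure lborel {\<theta> \<in> ?A. x n + cis \<theta> \<in> B}) / ennreal (measure lborel ?A)"
    unfolding step_law_def
    by (subst emeasure_uniform_measure) (auto simp: eq fin[of ?A] fin[of "{\<theta> \<in> ?A. x n + cis \<theta> \<in> B}"])
  also have "\<dots> = ennreal (step_prob x n B)"
  \<comment> \<open>For a null set of admissible angles both sides are 0, by the conventions for
    division in \<open>ennreal\<close> and in \<open>real\<close>.\<close>
  proof (cases "measure lborel ?A = 0")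
    case True
    then have "measure lborel {\<theta> \<in> ?A. x n + cis \<theta> \<in> B} = 0"
      using fin[of ?A] fin[of "{\<theta> \<in> ?A. x n + cis \<theta> \<in> B}"] emeasure_mono[of "{\<theta> \<in> ?A. x n + cis \<theta> \<in> B}" ?A lborel]
      by auto
    then show ?thesis using True by (simp add: step_prob_def)
  next
    case False
    then show ?thesis by (simp add: step_prob_def divide_ennreal zero_less_measure_iff)
  qed
  finally show ?thesis .
qed

lemma measurable_hist:
  assumes "\<And>k. X k \<in> borel_measurable M"
  shows "hist X n \<in> measurable M (PiM {..n} (\<lambda>_. borel))"
  unfolding hist_def using assms by measurable

text \<open>The definition of the walk prescribes the joint law of history and next position on
  rectangles only. These form an intersection-stable generator, so the joint law is the measure
  built from the step density, and arbitrary nonnegative functionals can be integrated step by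
  step.\<close>

lemma nn_integral_walk_kernel:
  fixes X :: "nat \<Rightarrow> 'a \<Rightarrow> complex"
  assumes walk: "is_hull_avoiding_walk M X"
    and F: "F \<in> borel_measurable (PiM {..n} (\<lambda>_. borel) \<Otimes>\<^sub>M borel)"
  shows "(\<integral>\<^sup>+\<omega>. F (hist X n \<omega>, X (Suc n) \<omega>) \<partial>M)
    = (\<integral>\<^sup>+\<omega>. \<integral>\<^sup>+\<theta>. F (hist X n \<omega>, X n \<omega> + cis \<theta>) \<partial>step_law (hist X n \<omega>) n \<partial>M)"
proof -
  interpret prob_space M using walk by (simp add: is_hull_avoiding_walk_def)
  define P :: "(nat \<Rightarrow> complex) measure" where "P = PiM {..n} (\<lambda>_. borel)"
  have X [measurable]: "X k \<in> borel_measurable M" for k using walk by (simp add: is_hull_avoiding_walk_def)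
  have hist [measurable]: "hist X n \<in> measurable M P" unfolding P_def by (rule measurable_hist) (rule X)
  have comp [measurable]: "(\<lambda>h. h s) \<in> borel_measurable P" if "s \<le> n" for s
    unfolding P_def using that by (intro measurable_component_singleton) auto
  have comp' [measurable]: "(\<lambda>z. fst z s) \<in> borel_measurable (P \<Otimes>\<^sub>M lborel)" if "s \<le> n" for s
    using comp[OF that] by (rule measurable_compose[OF measurable_fst])
  define ind :: "(nat \<Rightarrow> complex) \<Rightarrow> real \<Rightarrow> ennreal" where "ind h \<theta> = indicator (admissible_angles h n) \<theta>" for h \<theta>
  have ind [measurable]: "case_prod ind \<in> borel_measurable (P \<Otimes>\<^sub>M lborel)"
  proof -
    have [measurable]: "Measurable.pred (P \<Otimes>\<^sub>M lborel) (\<lambda>z. admissible (fst z) n (snd z))"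
      by (rule pred_admissible) (auto intro: comp')
    have "case_prod ind = (\<lambda>z. if 0 \<le> snd z \<and> snd z < 2 * pi \<and> admissible (fst z) n (snd z) then 1 else 0)"
      by (auto simp: ind_def admissible_angles_def fun_eq_iff indicator_def)
    then show ?thesis by simp
  qed
  \<comment> \<open>The step density, jointly in history and angle. The normalising constant is
    written as an integral, so that its measurability in the history is that of a partial
    integral.\<close>
  define w where "w = (\<lambda>(h, \<theta>). ind h \<theta> / (\<integral>\<^sup>+\<theta>. ind h \<theta> \<partial>lborel))"
  have w [measurable]: "w \<in> borel_measurable (P \<Otimes>\<^sub>M lborel)" unfolding w_def by measurable
  have step: "step_law h n = density lborel (\<lambda>\<theta>. w (h, \<theta>))" for h
    by (simp add: step_law_def uniform_measure_def w_def ind_def)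
  define N where "N = distr M P (hist X n)"
  define e where "e = (\<lambda>(h, \<theta>). (h, h n + cis \<theta> :: complex))"
  have [measurable_cong]: "sets N = sets P" by (simp add: N_def)
  have [measurable]: "e \<in> measurable (P \<Otimes>\<^sub>M lborel) (P \<Otimes>\<^sub>M borel)" unfolding e_def by measurable
  define \<mu> where "\<mu> = distr (density (N \<Otimes>\<^sub>M lborel) w) (P \<Otimes>\<^sub>M borel) e"
  have int: "(\<integral>\<^sup>+z. G z \<partial>\<mu>) = (\<integral>\<^sup>+\<omega>. \<integral>\<^sup>+\<theta>. G (hist X n \<omega>, X n \<omega> + cis \<theta>) \<partial>step_law (hist X n \<omega>) n \<partial>M)"
    if [measurable]: "G \<in> borel_measurable (P \<Otimes>\<^sub>M borel)" for G
  proof -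
    have [measurable]: "w \<in> borel_measurable (N \<Otimes>\<^sub>M lborel)" "e \<in> measurable (N \<Otimes>\<^sub>M lborel) (P \<Otimes>\<^sub>M borel)" by measurable
    have "(\<integral>\<^sup>+z. G z \<partial>\<mu>) = (\<integral>\<^sup>+z. w z * G (e z) \<partial>(N \<Otimes>\<^sub>M lborel))"
      unfolding \<mu>_def by (subst nn_integral_distr) (auto simp: nn_integral_density)
    also have "\<dots> = (\<integral>\<^sup>+h. \<integral>\<^sup>+\<theta>. w (h, \<theta>) * G (e (h, \<theta>)) \<partial>lborel \<partial>N)"
      by (subst lborel.nn_integral_fst[symmetric]) auto
    also have "\<dots> = (\<integral>\<^sup>+\<omega>. \<integral>\<^sup>+\<theta>. w (hist X n \<omega>, \<theta>) * G (e (hist X n \<omega>, \<theta>)) \<partial>lborel \<partial>M)"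
      unfolding N_def by (subst nn_integral_distr) auto
    also have "\<dots> = (\<integral>\<^sup>+\<omega>. \<integral>\<^sup>+\<theta>. G (hist X n \<omega>, X n \<omega> + cis \<theta>) \<partial>step_law (hist X n \<omega>) n \<partial>M)"
    proof (rule nn_integral_cong)
      fix \<omega> assume "\<omega> \<in> space M"
      have hP: "hist X n \<omega> \<in> space P" using hist \<open>\<omega> \<in> space M\<close> by (rule measurable_space)
      have [measurable]: "(\<lambda>\<theta>. w (hist X n \<omega>, \<theta>)) \<in> borel_measurable lborel"
        using measurable_compose[OF measurable_Pair1'[OF hP] w] by simp
      have [measurable]: "(\<lambda>\<theta>. G (hist X n \<omega>, X n \<omega> + cis \<theta>)) \<in> borel_measurable lborel"
        by (rule measurable_compose[OF _ that]) (use hP in measurable)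
      show "(\<integral>\<^sup>+\<theta>. w (hist X n \<omega>, \<theta>) * G (e (hist X n \<omega>, \<theta>)) \<partial>lborel)
          = (\<integral>\<^sup>+\<theta>. G (hist X n \<omega>, X n \<omega> + cis \<theta>) \<partial>step_law (hist X n \<omega>) n)"
        unfolding step by (subst nn_integral_density) (auto simp: e_def)
    qed
    finally show ?thesis .
  qed
  let ?D = "distr M (P \<Otimes>\<^sub>M borel) (\<lambda>\<omega>. (hist X n \<omega>, X (Suc n) \<omega>))"
  let ?E = "{a \<times> b |a b. a \<in> sets P \<and> b \<in> sets (borel :: complex measure)}"
  have "?D = \<mu>"
  proof (rule measure_eqI_generator_eq[OF Int_stable_pair_measure_generator[of P borel]])
    show "?E \<subseteq> Pow (space P \<times> space borel)"
      using sets.space_closed[of P] sets.space_closed[of "borel :: complex measure"] by auto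
    show "sets ?D = sigma_sets (space P \<times> space borel) ?E" "sets \<mu> = sigma_sets (space P \<times> space borel) ?E"
      by (simp_all add: \<mu>_def sets_pair_measure)
    have "space P \<times> space borel \<in> ?E"
      using sets.top[of P] sets.top[of "borel :: complex measure"] by blast
    then show "range (\<lambda>_::nat. space P \<times> space borel) \<subseteq> ?E" by blast
    show "(\<Union>_::nat. space P \<times> space borel) = space P \<times> space (borel :: complex measure)" by simp
    interpret D: prob_space ?D by (rule prob_space_distr) measurable
    show "emeasure ?D (space P \<times> space borel) \<noteq> \<infinity>" by simp
    fix C assume "C \<in> ?E"
    then obtain H B where C: "C = H \<times> B" and [measurable]: "H \<in> sets P" "B \<in> sets borel" by auto
    have "emeasure ?D C = emeasure M {\<omega> \<in> space M. hist X n \<omega> \<in> H \<and> X (Suc n) \<omega> \<in> B}"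
      by (subst emeasure_distr) (auto simp: C intro!: arg_cong[where f = "emeasure M"])
    also have "\<dots> = (\<integral>\<^sup>+\<omega>. indicator {\<omega> \<in> space M. hist X n \<omega> \<in> H} \<omega> * ennreal (step_prob (\<lambda>k. X k \<omega>) n B) \<partial>M)"
      using walk \<open>H \<in> sets P\<close> \<open>B \<in> sets borel\<close> unfolding is_hull_avoiding_walk_def hist_def P_def by blast
    also have "\<dots> = (\<integral>\<^sup>+\<omega>. \<integral>\<^sup>+\<theta>. indicator C (hist X n \<omega>, X n \<omega> + cis \<theta>) \<partial>step_law (hist X n \<omega>) n \<partial>M)"
    proof (rule nn_integral_cong)
      fix \<omega> assume "\<omega> \<in> space M"
      have meas: "{\<theta>. X n \<omega> + cis \<theta> \<in> B} \<in> sets borel"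
        using measurable_sets_borel[of "\<lambda>\<theta>. X n \<omega> + cis \<theta>" borel B] by (simp add: vimage_def)
      have "(\<integral>\<^sup>+\<theta>. indicator C (hist X n \<omega>, X n \<omega> + cis \<theta>) \<partial>step_law (hist X n \<omega>) n)
          = (\<integral>\<^sup>+\<theta>. indicator H (hist X n \<omega>) * indicator {\<theta>. X n \<omega> + cis \<theta> \<in> B} \<theta> \<partial>step_law (hist X n \<omega>) n)"
        by (intro nn_integral_cong) (auto simp: C indicator_def)
      also have "\<dots> = indicator H (hist X n \<omega>) * emeasure (step_law (hist X n \<omega>) n) {\<theta>. X n \<omega> + cis \<theta> \<in> B}"
        using meas by (subst nn_integral_cmult) auto
      also have "emeasure (step_law (hist X n \<omega>) n) {\<theta>. X n \<omega> + cis \<theta> \<in> B} = ennreal (step_prob (\<lambda>k. X k \<omega>) n B)"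
        using emeasure_step_law[OF \<open>B \<in> sets borel\<close>, of "\<lambda>k. X k \<omega>" n]
          step_law_cong[of n "hist X n \<omega>" "\<lambda>k. X k \<omega>"] by simp
      finally show "indicator {\<omega> \<in> space M. hist X n \<omega> \<in> H} \<omega> * ennreal (step_prob (\<lambda>k. X k \<omega>) n B)
          = (\<integral>\<^sup>+\<theta>. indicator C (hist X n \<omega>, X n \<omega> + cis \<theta>) \<partial>step_law (hist X n \<omega>) n)"
        using \<open>\<omega> \<in> space M\<close>
        by (simp add: indicator_def)
    qed
    also have "\<dots> = (\<integral>\<^sup>+z. indicator C z \<partial>\<mu>)"
      by (rule int[symmetric]) (simp add: C)
    also have "\<dots> = emeasure \<mu> C"
      by (rule nn_integral_indicator) (simp add: C \<mu>_def)
    finally show "emeasure ?D C = emeasure \<mu> C" .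
  qed
  then have "(\<integral>\<^sup>+z. F z \<partial>?D) = (\<integral>\<^sup>+z. F z \<partial>\<mu>)" by simp
  moreover have "(\<integral>\<^sup>+z. F z \<partial>?D) = (\<integral>\<^sup>+\<omega>. F (hist X n \<omega>, X (Suc n) \<omega>) \<partial>M)"
    by (rule nn_integral_distr) (use F in \<open>auto simp: P_def[symmetric]\<close>)
  ultimately show ?thesis using int[of F] F by (simp add: P_def)
qed

lemma nn_integral_walk_step:
  fixes X :: "nat \<Rightarrow> 'a \<Rightarrow> complex"
  assumes walk: "is_hull_avoiding_walk M X"
    and F: "F \<in> borel_measurable (PiM {..Suc n} (\<lambda>_. borel))"
  shows "(\<integral>\<^sup>+\<omega>. F (hist X (Suc n) \<omega>) \<partial>M)
    = (\<integral>\<^sup>+\<omega>. \<integral>\<^sup>+\<theta>. F ((hist X n \<omega>)(Suc n := X n \<omega> + cis \<theta>)) \<partial>step_law (hist X n \<omega>) n \<partial>M)"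
proof -
  have "(\<lambda>(h, y). h(Suc n := y)) \<in> measurable (PiM {..n} (\<lambda>_. borel) \<Otimes>\<^sub>M borel) (PiM {..Suc n} (\<lambda>_. borel :: complex measure))"
    unfolding atMost_Suc by (rule measurable_add_dim)
  then have "(\<lambda>z. F (case z of (h, y) \<Rightarrow> h(Suc n := y))) \<in> borel_measurable (PiM {..n} (\<lambda>_. borel) \<Otimes>\<^sub>M borel)"
    using F by (rule measurable_compose)
  from nn_integral_walk_kernel[OF walk this] show ?thesis by (simp add: hist_Suc)
qed

text \<open>The admissible segment includes its end point, so the new position lies outside the
  interior of the old hull. A direction that supports the old hull from there still supports the
  hull after the new point is added.\<close>

lemma AE_walk_not_interior:
  assumes walk: "is_hull_avoiding_walk M X"
  shows "AE \<omega> in M. hist X n \<omega> n \<notin> interior (hull_upto (hist X n \<omega>) n)"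
proof (cases n)
  case 0
  then show ?thesis by (simp add: hull_upto_def)
next
  case (Suc k)
  have X [measurable]: "X k \<in> borel_measurable M" for k using walk by (simp add: is_hull_avoiding_walk_def)
  let ?P = "PiM {..Suc k} (\<lambda>_. borel :: complex measure)"
  have meas: "Measurable.pred ?P (\<lambda>h. h (Suc k) \<in> interior (hull_upto h (Suc k)))"
    by (rule pred_mem_interior_hull[where f = "\<lambda>h. h"]) (auto intro!: measurable_component_singleton)
  define F :: "(nat \<Rightarrow> complex) \<Rightarrow> ennreal" where
    "F h = indicator {h. h (Suc k) \<in> interior (hull_upto h (Suc k))} h" for h
  have F [measurable]: "F \<in> borel_measurable ?P" unfolding F_def
    using meas by measurable
  have "(\<integral>\<^sup>+\<theta>. F (h(Suc k := h k + cis \<theta>)) \<partial>step_law h k) = 0" for h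
  proof -
    have "F (h(Suc k := h k + cis \<theta>)) = 0" if "\<theta> \<in> admissible_angles h k" for \<theta>
    proof -
      let ?y = "h k + cis \<theta>"
      have "?y \<notin> interior (hull_upto h k)"
        using that unfolding admissible_angles_def admissible_def by auto
      then obtain v where v: "norm v = 1" "\<And>z. z \<in> hull_upto h k \<Longrightarrow> v \<bullet> z \<le> v \<bullet> ?y"
        using not_interior_supporting_direction[of "hull_upto h k" ?y] unfolding hull_upto_def
        by (metis convex_convex_hull)
      have "?y \<notin> interior (convex hull ((h(Suc k := ?y)) ` {..Suc k}))"
        by (rule not_interior_of_supporting[OF v(1)])
          (use v(2) in \<open>auto simp: hull_upto_def hull_inc atMost_Suc\<close>)
      then show ?thesis by (simp add: F_def hull_upto_def)
    qed
    then have "AE \<theta> in step_law h k. F (h(Suc k := h k + cis \<theta>)) = 0"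
      unfolding step_law_def by (intro AE_uniform_measureI AE_I2) auto
    then have "(\<integral>\<^sup>+\<theta>. F (h(Suc k := h k + cis \<theta>)) \<partial>step_law h k) = (\<integral>\<^sup>+\<theta>. 0 \<partial>step_law h k)"
      by (rule nn_integral_cong_AE)
    then show ?thesis by simp
  qed
  from this[of "hist X k _"] have "(\<integral>\<^sup>+\<omega>. F (hist X (Suc k) \<omega>) \<partial>M) = 0"
    by (subst nn_integral_walk_step[OF walk F]) simp
  moreover have "(\<lambda>\<omega>. F (hist X (Suc k) \<omega>)) \<in> borel_measurable M"
    by (rule measurable_compose[OF measurable_hist F]) (rule X)
  ultimately have "AE \<omega> in M. F (hist X (Suc k) \<omega>) = 0"
    by (simp add: nn_integral_0_iff_AE)
  then show ?thesis
    unfolding Suc by eventually_elim (auto simp: F_def indicator_def split: if_splits)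
qed

text \<open>Paths that end in the interior of their hull have probability zero, so a pathwise bound
  for one step is needed only for the others.\<close>

lemma nn_integral_walk_step_le:
  fixes W V :: "(nat \<Rightarrow> complex) \<Rightarrow> ennreal"
  assumes walk: "is_hull_avoiding_walk M X"
    and W: "W \<in> borel_measurable (PiM {..Suc n} (\<lambda>_. borel))"
    and step: "\<And>x. x n \<notin> interior (hull_upto x n) \<Longrightarrow>
      (\<integral>\<^sup>+\<theta>. W (x(Suc n := x n + cis \<theta>)) \<partial>step_law x n) \<le> V x"
  shows "(\<integral>\<^sup>+\<omega>. W (hist X (Suc n) \<omega>) \<partial>M) \<le> (\<integral>\<^sup>+\<omega>. V (hist X n \<omega>) \<partial>M)"
  unfolding nn_integral_walk_step[OF walk W]
proof (rule nn_integral_mono_AE)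
  show "AE \<omega> in M. (\<integral>\<^sup>+\<theta>. W ((hist X n \<omega>)(Suc n := X n \<omega> + cis \<theta>)) \<partial>step_law (hist X n \<omega>) n) \<le> V (hist X n \<omega>)"
    using AE_walk_not_interior[OF walk, of n]
  proof eventually_elim
    case (elim \<omega>)
    then show ?case using step[of "hist X n \<omega>"] by simp
  qed
qed

section \<open>Exponential supermartingales\<close>

lemma pred_farthest:
  assumes [measurable]: "\<And>k. k \<le> s \<Longrightarrow> (\<lambda>\<omega>. f \<omega> k) \<in> borel_measurable N"
  shows "Measurable.pred N (\<lambda>\<omega>. farthest \<epsilon> u (f \<omega>) s i)"
proof (cases "i \<le> s")
  case True
  have sector: "Measurable.pred N (\<lambda>\<omega>. in_sector \<epsilon> u (f \<omega> k - f \<omega> s))" if "k \<le> s" for k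
    unfolding in_sector_def using assms[OF that] assms[of s] by measurable
  have dist: "(\<lambda>\<omega>. norm (f \<omega> k - f \<omega> s)) \<in> borel_measurable N" if "k \<le> s" for k
    using assms[OF that] assms[of s] by measurable
  show ?thesis
    unfolding farthest_def
    by (intro pred_intros_logic pred_intros_finite sector borel_measurable_pred_less borel_measurable_le dist)
      (use True in auto)
next
  case False
  then show ?thesis by (simp add: farthest_def)
qed

lemma measurable_return_sum:
  assumes "\<And>s i. s \<le> n \<Longrightarrow> i \<le> s \<Longrightarrow> (\<lambda>x. a x s i) \<in> borel_measurable (PiM {..N} (\<lambda>_. borel))" and "n \<le> N"
  shows "return_sum a \<mu> n \<in> borel_measurable (PiM {..N} (\<lambda>_. borel))"
  unfolding return_sum_def
proof (intro borel_measurable_sum)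
  fix s i assume si: "s \<in> {..n}" "i \<in> {..s}"
  have comp [measurable]: "(\<lambda>x. x k :: complex) \<in> borel_measurable (PiM {..N} (\<lambda>_. borel))" if "k \<le> n" for k
    using that assms(2) by (intro measurable_component_singleton) auto
  have [measurable]: "(\<lambda>x. a x s i) \<in> borel_measurable (PiM {..N} (\<lambda>_. borel))" using si by (intro assms) auto
  have [measurable]: "(\<lambda>x. x s :: complex) \<in> borel_measurable (PiM {..N} (\<lambda>_. borel))"
    "(\<lambda>x. x i :: complex) \<in> borel_measurable (PiM {..N} (\<lambda>_. borel))"
    "(\<lambda>x. x n :: complex) \<in> borel_measurable (PiM {..N} (\<lambda>_. borel))" using si by (auto intro!: comp)
  show "(\<lambda>x. a x s i * exp (\<mu> * (dist (x s) (x i) - dist (x n) (x i)) - 2 * \<mu>\<^sup>2 * real (n - s)))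
      \<in> borel_measurable (PiM {..N} (\<lambda>_. borel))" by measurable
qed

lemma measurable_far_count:
  assumes "s \<le> N"
  shows "(\<lambda>x. far_count m x s i) \<in> borel_measurable (PiM {..N} (\<lambda>_. borel))"
proof -
  have [measurable]: "Measurable.pred (PiM {..N} (\<lambda>_. borel)) (\<lambda>x. farthest (2 * pi / real m) (grid m j) x s i)" for j
    by (rule pred_farthest[where f = "\<lambda>x. x"]) (use assms in \<open>auto intro!: measurable_component_singleton\<close>)
  show ?thesis unfolding far_count_def by measurable
qed

lemma measurable_pen_support:
  "n \<le> N \<Longrightarrow> (\<lambda>x. pen_support \<delta> e x n) \<in> borel_measurable (PiM {..N} (\<lambda>_. borel))"
proof (induction n)
  case 0
  have [measurable]: "(\<lambda>x. x 0 :: complex) \<in> borel_measurable (PiM {..N} (\<lambda>_. borel))"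
    by (intro measurable_component_singleton) auto
  show ?case by simp
next
  case (Suc n)
  have [measurable]: "(\<lambda>x. x (Suc n) :: complex) \<in> borel_measurable (PiM {..N} (\<lambda>_. borel))"
    using Suc.prems by (intro measurable_component_singleton) auto
  have [measurable]: "(\<lambda>x. pen_support \<delta> e x n) \<in> borel_measurable (PiM {..N} (\<lambda>_. borel))"
    using Suc by simp
  show ?case by simp
qed

lemma far_count_upd: "s < k \<Longrightarrow> far_count m (x(k := y)) s i = far_count m x s i"
proof -
  assume "s < k"
  then have "farthest \<epsilon> u (x(k := y)) s i = farthest \<epsilon> u x s i" for \<epsilon> u
    by (intro farthest_cong) auto
  then show ?thesis by (simp add: far_count_def)
qed

lemma return_sum_far_count_upd:
  "n < k \<Longrightarrow> return_sum (far_count m) \<mu> n (x(k := y)) = return_sum (far_count m) \<mu> n x"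
  unfolding return_sum_def by (intro sum.cong refl) (auto simp: far_count_upd)

lemma return_sum_far_count_step:
  assumes out: "x n \<notin> interior (hull_upto x n)" and \<mu>: "0 \<le> \<mu>" "\<mu> \<le> 1"
  shows "(\<integral>\<^sup>+\<theta>. ennreal (return_sum (far_count m) \<mu> (Suc n) (x(Suc n := x n + cis \<theta>))) \<partial>step_law x n)
    \<le> ennreal (exp (- \<mu>\<^sup>2) * return_sum (far_count m) \<mu> n x + real m)"
  by (rule return_sum_step[OF out \<mu>]) (auto simp: far_count_nonneg far_count_sum_le far_count_upd)

text \<open>\<open>stuck\<close> marks the times at which \<open>exists_uncovered_direction\<close> is not applicable.\<close>

definition stuck :: "nat \<Rightarrow> real \<Rightarrow> nat \<Rightarrow> (nat \<Rightarrow> complex) \<Rightarrow> real" where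
  "stuck m \<mu> n x = of_bool (exp (\<mu> * real m / (16 * pi)) \<le> return_sum (far_count m) \<mu> n x)"

lemma stuck_upd: "n < k \<Longrightarrow> stuck m \<mu> n (x(k := y)) = stuck m \<mu> n x"
  by (simp add: stuck_def return_sum_far_count_upd)

lemma measurable_return_sum_far_count:
  "n \<le> N \<Longrightarrow> return_sum (far_count m) \<mu> n \<in> borel_measurable (PiM {..N} (\<lambda>_. borel))"
  by (intro measurable_return_sum measurable_far_count) auto

lemma measurable_stuck:
  assumes "n \<le> N"
  shows "stuck m \<mu> n \<in> borel_measurable (PiM {..N} (\<lambda>_. borel))"
proof -
  have [measurable]: "return_sum (far_count m) \<mu> n \<in> borel_measurable (PiM {..N} (\<lambda>_. borel))"
    using assms by (rule measurable_return_sum_far_count)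
  show ?thesis unfolding stuck_def[abs_def] by measurable
qed

text \<open>An exponential moment of the number of stuck times, turned into a supermartingale by the
  Lyapunov function 1 + r psi, where psi is the return sum. Its growth over an ordinary step is at
  most 1 + m r and is paid for by exp (- m r); at a stuck time psi is so large that its contraction
  pays for exp c.\<close>

definition stuck_weight :: "real \<Rightarrow> real \<Rightarrow> nat \<Rightarrow> real \<Rightarrow> nat \<Rightarrow> (nat \<Rightarrow> complex) \<Rightarrow> real" where
  "stuck_weight c r m \<mu> n x =
     (1 + r * return_sum (far_count m) \<mu> n x) * exp (\<Sum>k<n. c * stuck m \<mu> k x - real m * r)"

lemma measurable_stuck_weight: "stuck_weight c r m \<mu> n \<in> borel_measurable (PiM {..n} (\<lambda>_. borel))"
proof -
  have [measurable]: "return_sum (far_count m) \<mu> n \<in> borel_measurable (PiM {..n} (\<lambda>_. borel))"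
    by (rule measurable_return_sum_far_count) simp
  have [measurable]: "(\<lambda>x. \<Sum>k<n. c * stuck m \<mu> k x - real m * r) \<in> borel_measurable (PiM {..n} (\<lambda>_. borel))"
  proof (intro borel_measurable_sum)
    fix k assume "k \<in> {..<n}"
    then have [measurable]: "stuck m \<mu> k \<in> borel_measurable (PiM {..n} (\<lambda>_. borel))"
      by (intro measurable_stuck) auto
    show "(\<lambda>x. c * stuck m \<mu> k x - real m * r) \<in> borel_measurable (PiM {..n} (\<lambda>_. borel))" by measurable
  qed
  show ?thesis unfolding stuck_weight_def[abs_def] by measurable
qed

lemma return_sum_far_count_nonneg: "0 \<le> return_sum (far_count m) \<mu> n x"
  by (rule return_sum_nonneg) (rule far_count_nonneg)

text \<open>\<open>r\<close> is the inverse square root of the stuck threshold. Hence at a stuck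
  time r psi >= 1 / r, and by \<open>small\<close> the additive terms are a small part of r psi:
  half of the gain 1 - q absorbs them, and the remaining contraction (1 + q) / 2 cancels exp
  c.\<close>

lemma stuck_weight_step:
  assumes out: "x n \<notin> interior (hull_upto x n)" and \<mu>: "0 \<le> \<mu>" "\<mu> \<le> 1"
    and q: "q = exp (- \<mu>\<^sup>2)" and c: "exp c = 2 / (1 + q)" and r: "r = exp (- (\<mu> * real m / (32 * pi)))"
    and small: "r * (1 + real m * r) \<le> (1 - q) / 2"
  shows "(\<integral>\<^sup>+\<theta>. ennreal (stuck_weight c r m \<mu> (Suc n) (x(Suc n := x n + cis \<theta>))) \<partial>step_law x n)
    \<le> ennreal (stuck_weight c r m \<mu> n x)"
proof -
  interpret prob_space "step_law x n" by (rule prob_space_step_law) (rule out)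
  define \<psi> where "\<psi> = return_sum (far_count m) \<mu> n x"
  define E where "E = exp (\<Sum>k<n. c * stuck m \<mu> k x - real m * r)"
  define B where "B = stuck m \<mu> n x"
  have \<psi>0: "0 \<le> \<psi>" unfolding \<psi>_def by (rule return_sum_far_count_nonneg)
  have r0: "0 < r" by (simp add: r)
  have q01: "0 < q" "q \<le> 1" by (simp_all add: q)
  let ?R = "\<lambda>\<theta>. return_sum (far_count m) \<mu> (Suc n) (x(Suc n := x n + cis \<theta>))"
  have sum_eq: "(\<Sum>k<Suc n. c * stuck m \<mu> k (x(Suc n := y)) - real m * r)
      = (\<Sum>k<n. c * stuck m \<mu> k x - real m * r) + (c * B - real m * r)" for y
  proof -
    have "(\<Sum>k<Suc n. c * stuck m \<mu> k (x(Suc n := y)) - real m * r) = (\<Sum>k<Suc n. c * stuck m \<mu> k x - real m * r)"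
      by (intro sum.cong refl) (auto simp: stuck_upd)
    then show ?thesis by (simp add: B_def)
  qed
  have "stuck_weight c r m \<mu> (Suc n) (x(Suc n := x n + cis \<theta>)) = E * exp (c * B - real m * r) * (1 + r * ?R \<theta>)" for \<theta>
    unfolding stuck_weight_def sum_eq by (simp add: E_def exp_add)
  then have "(\<integral>\<^sup>+\<theta>. ennreal (stuck_weight c r m \<mu> (Suc n) (x(Suc n := x n + cis \<theta>))) \<partial>step_law x n)
      = (\<integral>\<^sup>+\<theta>. ennreal (E * exp (c * B - real m * r)) * (1 + ennreal r * ennreal (?R \<theta>)) \<partial>step_law x n)"
    using r0 return_sum_far_count_nonneg by (simp add: ennreal_mult E_def)
  also have "\<dots> = ennreal (E * exp (c * B - real m * r)) * (1 + ennreal r * (\<integral>\<^sup>+\<theta>. ennreal (?R \<theta>) \<partial>step_law x n))"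
  proof -
    have meas [measurable]: "?R \<in> borel_measurable borel"
    proof -
      \<comment> \<open>Measurability is known on the product space of finite histories; the path is
        cut off to become an element of it, which does not change the return sum.\<close>
      have 1: "(\<lambda>\<theta>. restrict (x(Suc n := x n + cis \<theta>)) {..Suc n}) \<in> measurable borel (PiM {..Suc n} (\<lambda>_. borel))"
      proof (rule measurable_restrict)
        fix i show "(\<lambda>\<theta>. (x(Suc n := x n + cis \<theta>)) i) \<in> borel_measurable borel"
          by (cases "i = Suc n") auto
      qed
      have 2: "return_sum (far_count m) \<mu> (Suc n) (restrict y {..Suc n}) = return_sum (far_count m) \<mu> (Suc n) y" for y
      proof -
        have "far_count m (restrict y {..Suc n}) s i = far_count m y s i" if "s \<le> Suc n" for s i
          unfolding far_count_def using that by (intro sum.cong refl arg_cong[where f = of_bool] farthest_cong) auto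
        then show ?thesis unfolding return_sum_def by (intro sum.cong refl) auto
      qed
      show ?thesis
        using measurable_compose[OF 1 measurable_return_sum_far_count[of "Suc n" "Suc n" m \<mu>]] by (simp add: 2)
    qed
    have "emeasure (step_law x n) UNIV = 1" using emeasure_space_1 by simp
    then show ?thesis
      by (simp add: nn_integral_cmult nn_integral_add)
  qed
  also have "\<dots> \<le> ennreal (E * exp (c * B - real m * r)) * (1 + ennreal r * ennreal (q * \<psi> + real m))"
    unfolding q \<psi>_def by (intro mult_left_mono add_left_mono return_sum_far_count_step out \<mu>) auto
  also have "\<dots> = ennreal (E * (exp (c * B - real m * r) * (1 + r * (q * \<psi> + real m))))"
  proof -
    let ?z = "1 + r * (q * \<psi> + real m)"
    have nn: "0 \<le> q * \<psi> + real m" using \<psi>0 q01 by simp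
    then have z0: "0 \<le> ?z" using r0 by simp
    have "1 + ennreal r * ennreal (q * \<psi> + real m) = ennreal 1 + ennreal (r * (q * \<psi> + real m))"
      using r0 nn by (simp only: ennreal_mult ennreal_1)
    also have "\<dots> = ennreal ?z"
      by (rule ennreal_plus[symmetric]) (use r0 nn in auto)
    finally have "ennreal (E * exp (c * B - real m * r)) * (1 + ennreal r * ennreal (q * \<psi> + real m))
        = ennreal (E * exp (c * B - real m * r)) * ennreal ?z" by (rule arg_cong)
    also have "\<dots> = ennreal (E * exp (c * B - real m * r) * ?z)"
      by (rule ennreal_mult[symmetric, OF _ z0]) (simp add: E_def)
    finally show ?thesis unfolding mult.assoc .
  qed
  also have "\<dots> \<le> ennreal (E * (1 + r * \<psi>))"
  proof (intro ennreal_leI mult_left_mono)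
    show "exp (c * B - real m * r) * (1 + r * (q * \<psi> + real m)) \<le> 1 + r * \<psi>"
    proof (cases "exp (\<mu> * real m / (16 * pi)) \<le> \<psi>")
      case True
      then have B1: "B = 1" by (simp add: B_def stuck_def \<psi>_def)
      define t where "t = \<mu> * real m / (32 * pi)"
      have "\<mu> * real m / (16 * pi) = t + t" by (simp add: t_def)
      moreover have "1 / exp (- t) = exp (- t) * exp (t + t)"
        using exp_add[of "- t" "t + t"] by (simp add: exp_minus inverse_eq_divide)
      ultimately have "1 / r = r * exp (\<mu> * real m / (16 * pi))" unfolding r t_def[symmetric] by simp
      also have "\<dots> \<le> r * \<psi>" using True r0 by (intro mult_left_mono) auto
      finally have r\<psi>: "1 / r \<le> r * \<psi>" .
      have "1 + real m * r \<le> (1 - q) / 2 * (1 / r)" using small r0 by (simp add: field_simps)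
      also have "\<dots> \<le> (1 - q) / 2 * (r * \<psi>)" using r\<psi> q01 by (intro mult_left_mono) auto
      finally have key: "2 * (1 + real m * r) \<le> (1 - q) * (r * \<psi>)" by simp
      have pos: "0 \<le> 1 + r * (q * \<psi> + real m)" using r0 \<psi>0 q01 by (simp add: add_nonneg_nonneg)
      have "exp (c * B - real m * r) \<le> exp c" using r0 by (simp add: B1)
      then have "exp (c * B - real m * r) * (1 + r * (q * \<psi> + real m)) \<le> 2 / (1 + q) * (1 + r * (q * \<psi> + real m))"
        using pos unfolding c[symmetric] by (rule mult_right_mono)
      also have "\<dots> \<le> 1 + r * \<psi>"
      proof -
        have "2 * (1 + r * (q * \<psi> + real m)) \<le> (1 + r * \<psi>) * (1 + q)"
          using key q01 by (simp add: algebra_simps)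
        then show ?thesis using q01 by (simp only: times_divide_eq_left pos_divide_le_eq)
      qed
      finally show ?thesis .
    next
      case False
      then have B0: "B = 0" by (simp add: B_def stuck_def \<psi>_def)
      have "1 + r * (q * \<psi> + real m) \<le> (1 + r * \<psi>) * (1 + real m * r)"
      proof -
        have "q * (r * \<psi>) \<le> 1 * (r * \<psi>)" using q01 r0 \<psi>0 by (intro mult_right_mono) auto
        moreover have "0 \<le> r * \<psi> * (real m * r)" using r0 \<psi>0 by simp
        ultimately show ?thesis by (simp add: algebra_simps)
      qed
      also have "\<dots> \<le> (1 + r * \<psi>) * exp (real m * r)"
        using r0 \<psi>0 by (intro mult_left_mono exp_ge_add_one_self) auto
      finally have "exp (- (real m * r)) * (1 + r * (q * \<psi> + real m)) \<le> exp (- (real m * r)) * ((1 + r * \<psi>) * exp (real m * r))"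
        by (intro mult_left_mono) auto
      also have "\<dots> = 1 + r * \<psi>" by (simp add: exp_minus field_simps)
      finally show ?thesis by (simp add: B0)
    qed
  qed (simp add: E_def)
  also have "E * (1 + r * \<psi>) = stuck_weight c r m \<mu> n x" by (simp add: stuck_weight_def E_def \<psi>_def)
  finally show ?thesis .
qed

text \<open>The exponential supermartingale of the potential; the sum in the exponent compensates
  the one-step bound of \<open>pen_sum_step\<close>. It is large when the potential stays small
  although few times are stuck.\<close>

definition width_weight :: "real \<Rightarrow> real \<Rightarrow> nat \<Rightarrow> real \<Rightarrow> nat \<Rightarrow> (nat \<Rightarrow> complex) \<Rightarrow> real" where
  "width_weight l \<delta> m \<mu> n x =
     exp (- l * pen_sum \<delta> m n x + (\<Sum>k<n. l * (1 / 64 - stuck m \<mu> k x / 48) - l\<^sup>2 * (real m)\<^sup>2))"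

lemma measurable_width_weight: "width_weight l \<delta> m \<mu> n \<in> borel_measurable (PiM {..n} (\<lambda>_. borel))"
proof -
  have [measurable]: "(\<lambda>x. pen_sum \<delta> m n x) \<in> borel_measurable (PiM {..n} (\<lambda>_. borel))"
    unfolding pen_sum_def by (intro borel_measurable_sum measurable_pen_support) simp
  have [measurable]: "(\<lambda>x. \<Sum>k<n. l * (1 / 64 - stuck m \<mu> k x / 48) - l\<^sup>2 * (real m)\<^sup>2) \<in> borel_measurable (PiM {..n} (\<lambda>_. borel))"
  proof (intro borel_measurable_sum)
    fix k assume "k \<in> {..<n}"
    then have [measurable]: "stuck m \<mu> k \<in> borel_measurable (PiM {..n} (\<lambda>_. borel))"
      by (intro measurable_stuck) auto
    show "(\<lambda>x. l * (1 / 64 - stuck m \<mu> k x / 48) - l\<^sup>2 * (real m)\<^sup>2) \<in> borel_measurable (PiM {..n} (\<lambda>_. borel))" by measurable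
  qed
  show ?thesis unfolding width_weight_def[abs_def] by measurable
qed

lemma width_weight_step:
  assumes out: "x n \<notin> interior (hull_upto x n)"
    and m: "m \<ge> 128" and \<delta>: "\<delta> = 1 / (192 * real m)" and \<mu>: "\<mu> = 1 / (1536 * pi)"
    and l: "0 \<le> l" "l * real m \<le> 1"
  shows "(\<integral>\<^sup>+\<theta>. ennreal (width_weight l \<delta> m \<mu> (Suc n) (x(Suc n := x n + cis \<theta>))) \<partial>step_law x n)
    \<le> ennreal (width_weight l \<delta> m \<mu> n x)"
proof -
  define d where "d = l * (1 / 64 - stuck m \<mu> n x / 48) - l\<^sup>2 * (real m)\<^sup>2"
  define V where "V = width_weight l \<delta> m \<mu> n x"
  let ?S = "\<lambda>\<theta>. pen_sum \<delta> m (Suc n) (x(Suc n := x n + cis \<theta>)) - pen_sum \<delta> m n x"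
  have sum_eq: "(\<Sum>k<Suc n. l * (1 / 64 - stuck m \<mu> k (x(Suc n := y)) / 48) - l\<^sup>2 * (real m)\<^sup>2)
      = (\<Sum>k<n. l * (1 / 64 - stuck m \<mu> k x / 48) - l\<^sup>2 * (real m)\<^sup>2) + d" for y
  proof -
    have "(\<Sum>k<Suc n. l * (1 / 64 - stuck m \<mu> k (x(Suc n := y)) / 48) - l\<^sup>2 * (real m)\<^sup>2)
        = (\<Sum>k<Suc n. l * (1 / 64 - stuck m \<mu> k x / 48) - l\<^sup>2 * (real m)\<^sup>2)"
      by (intro sum.cong refl) (auto simp: stuck_upd)
    then show ?thesis by (simp add: d_def)
  qed
  have "width_weight l \<delta> m \<mu> (Suc n) (x(Suc n := x n + cis \<theta>)) = V * exp d * exp (- l * ?S \<theta>)" for \<theta>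
    unfolding V_def width_weight_def sum_eq exp_add[symmetric] by (simp add: algebra_simps)
  then have "(\<integral>\<^sup>+\<theta>. ennreal (width_weight l \<delta> m \<mu> (Suc n) (x(Suc n := x n + cis \<theta>))) \<partial>step_law x n)
      = (\<integral>\<^sup>+\<theta>. ennreal (V * exp d) * ennreal (exp (- l * ?S \<theta>)) \<partial>step_law x n)"
    by (simp add: ennreal_mult V_def width_weight_def)
  also have "\<dots> = ennreal (V * exp d) * (\<integral>\<^sup>+\<theta>. ennreal (exp (- l * ?S \<theta>)) \<partial>step_law x n)"
  proof (rule nn_integral_cmult)
    have "pen_support \<delta> e (x(Suc n := x n + cis \<theta>)) (Suc n) = max (pen_support \<delta> e x n - \<delta>) (e \<bullet> (x n + cis \<theta>))" for e \<theta>
      by (simp add: pen_support_upd)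
    then have "(\<lambda>\<theta>. pen_sum \<delta> m (Suc n) (x(Suc n := x n + cis \<theta>))) \<in> borel_measurable borel"
      unfolding pen_sum_def by (simp del: pen_support.simps)
    then show "(\<lambda>\<theta>. ennreal (exp (- l * ?S \<theta>))) \<in> borel_measurable (step_law x n)" by measurable
  qed
  also have "\<dots> \<le> ennreal (V * exp d) * ennreal (exp (- l * (1 / 64 - stuck m \<mu> n x / 48) + l\<^sup>2 * (real m)\<^sup>2))"
    by (intro mult_left_mono pen_sum_step[OF out m \<delta> \<mu> l]) (auto simp: stuck_def)
  also have "\<dots> = ennreal (V * exp d * exp (- l * (1 / 64 - stuck m \<mu> n x / 48) + l\<^sup>2 * (real m)\<^sup>2))"
    by (rule ennreal_mult[symmetric]) (auto simp: V_def width_weight_def)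
  also have "V * exp d * exp (- l * (1 / 64 - stuck m \<mu> n x / 48) + l\<^sup>2 * (real m)\<^sup>2) = V"
  proof -
    have "exp d * exp (- l * (1 / 64 - stuck m \<mu> n x / 48) + l\<^sup>2 * (real m)\<^sup>2) = 1"
      unfolding exp_add[symmetric] by (simp add: d_def)
    then show ?thesis unfolding mult.assoc[of V] by simp
  qed
  finally show ?thesis unfolding V_def .
qed

section \<open>Bounds in expectation along the walk\<close>

text \<open>The bound is the fixed point of the recursion y -> q y + J with q = exp (- \<mu>^2). It
  is applied with all weight on the starting point, to control drops of the distance to the
  origin.\<close>

lemma expectation_return_sum_le:
  fixes X :: "nat \<Rightarrow> 'a \<Rightarrow> complex"
  assumes walk: "is_hull_avoiding_walk M X" and \<mu>: "0 < \<mu>" "\<mu> \<le> 1"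
    and nn: "\<And>x s i. 0 \<le> a x s i" and J: "\<And>x s. (\<Sum>i\<le>s. a x s i) \<le> J"
    and a_upd: "\<And>n x y s i. s \<le> n \<Longrightarrow> a (x(Suc n := y)) s i = a x s i"
    and meas: "\<And>n. return_sum a \<mu> n \<in> borel_measurable (PiM {..n} (\<lambda>_. borel))"
  shows "(\<integral>\<^sup>+\<omega>. ennreal (return_sum a \<mu> n (hist X n \<omega>)) \<partial>M) \<le> ennreal (J / (1 - exp (- \<mu>\<^sup>2)))"
proof -
  interpret prob_space M using walk by (simp add: is_hull_avoiding_walk_def)
  let ?q = "exp (- \<mu>\<^sup>2)"
  have q: "0 < ?q" "?q < 1" using \<mu> by auto
  have "0 \<le> (\<Sum>i\<le>0. a (\<lambda>_. 0) 0 i)" by (intro sum_nonneg nn)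
  then have J0: "0 \<le> J" using J[where x = "\<lambda>_. 0" and s = 0] by linarith
  show ?thesis
  proof (induction n)
    case 0
    have "return_sum a \<mu> 0 x \<le> J / (1 - ?q)" for x
    proof -
      have "return_sum a \<mu> 0 x \<le> J" using J[where x = x and s = 0] by (simp add: return_sum_def)
      also have "J * (1 - ?q) \<le> J * 1" using q J0 by (intro mult_left_mono) auto
      then have "J \<le> J / (1 - ?q)" using q by (simp add: pos_le_divide_eq)
      finally show ?thesis .
    qed
    then have "(\<integral>\<^sup>+\<omega>. ennreal (return_sum a \<mu> 0 (hist X 0 \<omega>)) \<partial>M) \<le> (\<integral>\<^sup>+\<omega>. ennreal (J / (1 - ?q)) \<partial>M)"
      by (intro nn_integral_mono ennreal_leI)
    then show ?case by (simp add: emeasure_space_1)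
  next
    case (Suc n)
    have meas_hist: "(\<lambda>\<omega>. return_sum a \<mu> n (hist X n \<omega>)) \<in> borel_measurable M"
      by (rule measurable_compose[OF measurable_hist meas]) (use walk in \<open>simp add: is_hull_avoiding_walk_def\<close>)
    have "(\<integral>\<^sup>+\<omega>. ennreal (return_sum a \<mu> (Suc n) (hist X (Suc n) \<omega>)) \<partial>M)
        \<le> (\<integral>\<^sup>+\<omega>. ennreal (?q * return_sum a \<mu> n (hist X n \<omega>) + J) \<partial>M)"
    proof (rule nn_integral_walk_step_le[OF walk])
      show "(\<lambda>x. ennreal (return_sum a \<mu> (Suc n) x)) \<in> borel_measurable (PiM {..Suc n} (\<lambda>_. borel))"
        using meas[of "Suc n"] by measurable
      show "(\<integral>\<^sup>+\<theta>. ennreal (return_sum a \<mu> (Suc n) (x(Suc n := x n + cis \<theta>))) \<partial>step_law x n)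
          \<le> ennreal (?q * return_sum a \<mu> n x + J)" if "x n \<notin> interior (hull_upto x n)" for x
        using that \<mu> by (intro return_sum_step nn J a_upd) auto
    qed
    also have "\<dots> = (\<integral>\<^sup>+\<omega>. ennreal ?q * ennreal (return_sum a \<mu> n (hist X n \<omega>)) + ennreal J \<partial>M)"
      using J0 q return_sum_nonneg[OF nn] by (intro nn_integral_cong) (simp add: ennreal_mult)
    also have "\<dots> = ennreal ?q * (\<integral>\<^sup>+\<omega>. ennreal (return_sum a \<mu> n (hist X n \<omega>)) \<partial>M) + ennreal J"
      using meas_hist by (subst nn_integral_add) (auto simp: nn_integral_cmult emeasure_space_1)
    also have "\<dots> \<le> ennreal ?q * ennreal (J / (1 - ?q)) + ennreal J"
      by (intro add_right_mono mult_left_mono Suc) auto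
    also have "\<dots> = ennreal (?q * (J / (1 - ?q)) + J)"
      using q J0 by (simp add: ennreal_mult[symmetric] ennreal_plus[symmetric] del: ennreal_plus)
    also have "?q * (J / (1 - ?q)) + J = J / (1 - ?q)" using q by (simp add: field_simps)
    finally show ?case .
  qed
qed

lemma expectation_supermartingale_le:
  fixes X :: "nat \<Rightarrow> 'a \<Rightarrow> complex"
  assumes walk: "is_hull_avoiding_walk M X"
    and meas: "\<And>n. W n \<in> borel_measurable (PiM {..n} (\<lambda>_. borel))"
    and step: "\<And>n x. x n \<notin> interior (hull_upto x n) \<Longrightarrow>
      (\<integral>\<^sup>+\<theta>. ennreal (W (Suc n) (x(Suc n := x n + cis \<theta>))) \<partial>step_law x n) \<le> ennreal (W n x)"
    and init: "\<And>x. x 0 = 0 \<Longrightarrow> W 0 x \<le> C"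
  shows "(\<integral>\<^sup>+\<omega>. ennreal (W n (hist X n \<omega>)) \<partial>M) \<le> ennreal C"
proof -
  interpret prob_space M using walk by (simp add: is_hull_avoiding_walk_def)
  show ?thesis
  proof (induction n)
    case 0
    have "hist X 0 \<omega> 0 = 0" if "\<omega> \<in> space M" for \<omega>
      using walk that by (simp add: is_hull_avoiding_walk_def)
    then have "(\<integral>\<^sup>+\<omega>. ennreal (W 0 (hist X 0 \<omega>)) \<partial>M) \<le> (\<integral>\<^sup>+\<omega>. ennreal C \<partial>M)"
      by (intro nn_integral_mono ennreal_leI init)
    then show ?case by (simp add: emeasure_space_1)
  next
    case (Suc n)
    have "(\<integral>\<^sup>+\<omega>. ennreal (W (Suc n) (hist X (Suc n) \<omega>)) \<partial>M) \<le> (\<integral>\<^sup>+\<omega>. ennreal (W n (hist X n \<omega>)) \<partial>M)"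
    proof (rule nn_integral_walk_step_le[OF walk])
      show "(\<lambda>x. ennreal (W (Suc n) x)) \<in> borel_measurable (PiM {..Suc n} (\<lambda>_. borel))"
        using meas[of "Suc n"] by measurable
    qed (rule step)
    then show ?case using Suc by (rule order_trans)
  qed
qed

lemma (in prob_space) prob_exp_le:
  fixes W :: "'a \<Rightarrow> real"
  assumes [measurable]: "W \<in> borel_measurable M" and E: "(\<integral>\<^sup>+\<omega>. ennreal (W \<omega>) \<partial>M) \<le> ennreal C" and C: "0 \<le> C"
  shows "prob {\<omega> \<in> space M. exp t \<le> W \<omega>} \<le> C * exp (- t)"
proof -
  let ?A = "{\<omega> \<in> space M. exp t \<le> W \<omega>}"
  have "ennreal (exp t * prob ?A) = (\<integral>\<^sup>+\<omega>. ennreal (exp t) * indicator ?A \<omega> \<partial>M)"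
    by (simp add: nn_integral_cmult emeasure_eq_measure ennreal_mult)
  also have "\<dots> \<le> (\<integral>\<^sup>+\<omega>. ennreal (W \<omega>) \<partial>M)"
    by (intro nn_integral_mono) (auto simp: indicator_def intro: ennreal_leI)
  also note E
  finally have "exp t * prob ?A \<le> C" using C by simp
  then show ?thesis by (simp add: exp_minus field_simps)
qed

section \<open>Choice of the constants and the exponential estimate\<close>

text \<open>Since \<mu>, c and q do not depend on \<open>m\<close>, \<open>r\<close> is the
  \<open>m\<close>-th power of a fixed number below 1 and beats the linear factor
  \<open>m\<close>.\<close>

lemma exists_fine_grid:
  fixes \<mu> c q :: real
  assumes "0 < \<mu>" "0 < c" "q < 1"
  obtains m :: nat and r where "m \<ge> 128" "r = exp (- (\<mu> * real m / (32 * pi)))"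
    "real m * r \<le> c / 8" "r * (1 + real m * r) \<le> (1 - q) / 2" "real m * r \<le> 1"
proof -
  define \<rho> where "\<rho> = exp (- (\<mu> / (32 * pi)))"
  have \<rho>: "norm \<rho> < 1" using assms(1) pi_gt_zero by (simp add: \<rho>_def)
  have lim1: "(\<lambda>m. real m * \<rho> ^ m) \<longlonglongrightarrow> 0" using powser_times_n_limit_0[OF \<rho>] by simp
  have lim2: "(\<lambda>m. \<rho> ^ m) \<longlonglongrightarrow> 0" using \<rho> by (rule LIMSEQ_power_zero)
  have lim3: "(\<lambda>m. \<rho> ^ m * (1 + real m * \<rho> ^ m)) \<longlonglongrightarrow> 0 * (1 + 0)"
    by (intro tendsto_intros lim1 lim2)
  have "eventually (\<lambda>m. real m * \<rho> ^ m < min (c / 8) 1) sequentially"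
    using assms by (intro order_tendstoD(2)[OF lim1]) auto
  moreover have "eventually (\<lambda>m. \<rho> ^ m * (1 + real m * \<rho> ^ m) < (1 - q) / 2) sequentially"
    using assms by (intro order_tendstoD(2)[OF lim3]) auto
  moreover have "eventually (\<lambda>m::nat. m \<ge> 128) sequentially" by (rule eventually_ge_at_top)
  ultimately have "eventually (\<lambda>m. real m * \<rho> ^ m < min (c / 8) 1 \<and>
      \<rho> ^ m * (1 + real m * \<rho> ^ m) < (1 - q) / 2 \<and> m \<ge> 128) sequentially"
    by eventually_elim auto
  then obtain m where m: "real m * \<rho> ^ m < min (c / 8) 1" "\<rho> ^ m * (1 + real m * \<rho> ^ m) < (1 - q) / 2" "m \<ge> 128"
    using eventually_happens[of _ sequentially] by auto
  have "\<rho> ^ m = exp (- (\<mu> * real m / (32 * pi)))"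
    by (simp add: \<rho>_def exp_of_nat_mult[symmetric] mult.commute)
  then show thesis using m by (intro that[of m "\<rho> ^ m"]) auto
qed

lemma far_from_origin:
  assumes m: "m > 0" and \<delta>: "0 \<le> \<delta>" and wide: "b < pen_sum \<delta> m n x"
  obtains s where "s \<le> n" "b / real m \<le> norm (x s)"
proof -
  have "\<exists>j<m. b / real m \<le> pen_support \<delta> (grid m j) x n"
  proof (rule ccontr)
    assume "\<not> ?thesis"
    then have "pen_sum \<delta> m n x \<le> (\<Sum>j<m. b / real m)"
      unfolding pen_sum_def by (intro sum_mono) auto
    then show False using wide m by simp
  qed
  then obtain j where j: "b / real m \<le> pen_support \<delta> (grid m j) x n" by blast
  obtain s where s: "s \<le> n" "pen_support \<delta> (grid m j) x n = grid m j \<bullet> x s - \<delta> * real (n - s)"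
    using pen_support_attained by blast
  have "grid m j \<bullet> x s \<le> norm (x s)" using norm_cauchy_schwarz[of "grid m j" "x s"] by simp
  then have "b / real m \<le> norm (x s)"
    using j s(2) \<delta> by (smt (verit) mult_nonneg_nonneg of_nat_0_le_iff)
  then show thesis using s(1) by (intro that)
qed

text \<open>A walk close to its start has many stuck times, or a small potential despite few of
  them, or has returned from a distant point. Each alternative makes one of three nonnegative
  quantities of bounded expectation exponentially large.\<close>

lemma walk_displacement_cases:
  assumes m: "m > 0" and \<delta>: "0 \<le> \<delta>" and r: "0 \<le> r" "real m * r \<le> c / 8" and x0: "x 0 = 0"
    and l: "l = 1 / (384 * (real m)\<^sup>2)" and c1: "c1 = 1 / (768 * real m)"
    and close: "norm (x n) \<le> c1 * real n"
  shows "exp (c / 8 * real n) \<le> stuck_weight c r m \<mu> n x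
    \<or> exp (l / 192 * real n) \<le> width_weight l \<delta> m \<mu> n x
    \<or> exp (c1\<^sup>2 / 8 * real n) \<le> return_sum (\<lambda>x s i. of_bool (i = 0)) (c1 / 4) n x"
proof -
  let ?B = "\<Sum>k<n. stuck m \<mu> k x"
  have c0: "0 \<le> c" using order_trans[OF mult_nonneg_nonneg r(2)] r(1) by simp
  consider "real n / 4 \<le> ?B" | "?B < real n / 4" "pen_sum \<delta> m n x \<le> real n / 384" | "real n / 384 < pen_sum \<delta> m n x"
    by linarith
  then show ?thesis
  proof cases
    case 1
    have "c * (real n / 4) \<le> c * ?B" using c0 1 by (intro mult_left_mono) auto
    moreover have "real n * (real m * r) \<le> real n * (c / 8)" using r by (intro mult_left_mono) auto
    moreover have "(\<Sum>k<n. c * stuck m \<mu> k x - real m * r) = c * ?B - real n * (real m * r)"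
      by (simp add: sum_subtractf sum_distrib_left)
    ultimately have "c / 8 * real n \<le> (\<Sum>k<n. c * stuck m \<mu> k x - real m * r)" by (simp add: algebra_simps)
    then have "exp (c / 8 * real n) \<le> 1 * exp (\<Sum>k<n. c * stuck m \<mu> k x - real m * r)" by simp
    also have "\<dots> \<le> stuck_weight c r m \<mu> n x"
      unfolding stuck_weight_def using r(1) return_sum_far_count_nonneg[of m \<mu> n x]
      by (intro mult_right_mono) auto
    finally show ?thesis by simp
  next
    case 2
    have l0: "0 \<le> l" by (simp add: l)
    have lm: "l\<^sup>2 * (real m)\<^sup>2 = l / 384" using m by (simp add: l power2_eq_square)
    have "(\<Sum>k<n. l * (1 / 64 - stuck m \<mu> k x / 48) - l\<^sup>2 * (real m)\<^sup>2) = l * (real n / 64 - ?B / 48 - real n / 384)"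
      unfolding lm by (simp add: sum_subtractf sum_distrib_left[symmetric] sum_divide_distrib[symmetric] algebra_simps)
    then have "- l * pen_sum \<delta> m n x + (\<Sum>k<n. l * (1 / 64 - stuck m \<mu> k x / 48) - l\<^sup>2 * (real m)\<^sup>2)
        = l * (real n / 64 - ?B / 48 - real n / 384 - pen_sum \<delta> m n x)" by (simp add: algebra_simps)
    \<comment> \<open>The budget per unit of time: 1/64, less at most 1/192 for the stuck times,
      1/384 for the quadratic term (hence the value of \<open>l\<close>) and 1/384 for the
      potential, leaves 1/192.\<close>
    moreover have "l * (real n / 192) \<le> l * (real n / 64 - ?B / 48 - real n / 384 - pen_sum \<delta> m n x)"
      using l0 2 by (intro mult_left_mono) auto
    ultimately show ?thesis by (simp add: width_weight_def)
  next
    case 3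
    obtain s where s: "s \<le> n" "real n / 384 / real m \<le> norm (x s)"
      using far_from_origin[OF m \<delta> 3] by blast
    \<comment> \<open>\<open>c1\<close> is half the speed that the potential guarantees for the
      maximum, so ending within c1 n of the origin is a drop by at least c1 n.\<close>
    have "2 * (c1 * real n) \<le> norm (x s)" using s(2) m by (simp add: c1 field_simps)
    then have drop: "c1 * real n \<le> dist (x s) (x 0) - dist (x n) (x 0)" using close by (simp add: x0)
    have c1: "0 \<le> c1" by (simp add: c1)
    have "exp (c1\<^sup>2 / 8 * real n) \<le> return_sum (\<lambda>x s i. of_bool (i = 0)) (c1 / 4) n x"
    proof (rule return_sum_ge[of _ _ s n 0])
      \<comment> \<open>The rate c1 / 4 maximises c1 y - 2 y^2 over y, with maximum c1^2 /
        8.\<close>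
      have "c1 / 4 * (c1 * real n) \<le> c1 / 4 * (dist (x s) (x 0) - dist (x n) (x 0))"
        using c1 drop by (intro mult_left_mono) auto
      moreover have "2 * (c1 / 4)\<^sup>2 * real (n - s) \<le> 2 * (c1 / 4)\<^sup>2 * real n" by (intro mult_left_mono) auto
      ultimately show "c1\<^sup>2 / 8 * real n \<le> c1 / 4 * (dist (x s) (x 0) - dist (x n) (x 0)) - 2 * (c1 / 4)\<^sup>2 * real (n - s)"
        by (simp add: power2_eq_square algebra_simps)
    qed (use s in auto)
    then show ?thesis by simp
  qed
qed

lemma walk_small_displacement_exp_decay:
  fixes X :: "nat \<Rightarrow> 'a \<Rightarrow> complex"
  assumes walk: "is_hull_avoiding_walk M X"
  obtains c1 C b where "0 < c1" "0 < C" "0 < b"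
    "\<And>n. measure M {\<omega> \<in> space M. norm (X n \<omega>) \<le> c1 * real n} \<le> C * exp (- b * real n)"
proof -
  interpret prob_space M using walk by (simp add: is_hull_avoiding_walk_def)
  have X [measurable]: "X k \<in> borel_measurable M" for k using walk by (simp add: is_hull_avoiding_walk_def)
  have hist_meas: "hist X n \<in> measurable M (PiM {..n} (\<lambda>_. borel))" for n by (rule measurable_hist) (rule X)
  define \<mu> where "\<mu> = 1 / (1536 * pi)"
  have \<mu>: "0 < \<mu>" "\<mu> \<le> 1" using pi_gt3 by (auto simp: \<mu>_def)
  define q where "q = exp (- \<mu>\<^sup>2)"
  have q: "0 < q" "q < 1" using \<mu> by (auto simp: q_def)
  \<comment> \<open>exp c is the reciprocal of (1 + q) / 2, the contraction left at a stuck time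
    once half of 1 - q has been spent on the additive terms.\<close>
  define c where "c = ln (2 / (1 + q))"
  have c: "0 < c" "exp c = 2 / (1 + q)" using q by (auto simp: c_def)
  obtain m r where m: "m \<ge> 128" and r: "r = exp (- (\<mu> * real m / (32 * pi)))" "real m * r \<le> c / 8"
    "r * (1 + real m * r) \<le> (1 - q) / 2" "real m * r \<le> 1"
    using exists_fine_grid[OF \<mu>(1) c(1) q(2)] by blast
  have r0: "0 \<le> r" by (simp add: r)
  define \<delta> where "\<delta> = 1 / (192 * real m)"
  define l where "l = 1 / (384 * (real m)\<^sup>2)"
  define c1 where "c1 = 1 / (768 * real m)"
  have m0: "m > 0" "0 \<le> \<delta>" "0 < l" "0 < c1" "c1 \<le> 1" using m by (auto simp: \<delta>_def l_def c1_def field_simps)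
  have lm: "l * real m \<le> 1" using m by (simp add: l_def power2_eq_square field_simps)
  define K where "K = 1 / (1 - exp (- (c1 / 4)\<^sup>2))"
  have K: "0 < K" using m0 by (simp add: K_def)
  define a where "a = (\<lambda>(x :: nat \<Rightarrow> complex) (s :: nat) (i :: nat). of_bool (i = 0) :: real)"
  have E1: "(\<integral>\<^sup>+\<omega>. ennreal (stuck_weight c r m \<mu> n (hist X n \<omega>)) \<partial>M) \<le> ennreal 2" for n
  proof (rule expectation_supermartingale_le[OF walk measurable_stuck_weight])
    show "(\<integral>\<^sup>+\<theta>. ennreal (stuck_weight c r m \<mu> (Suc n) (x(Suc n := x n + cis \<theta>))) \<partial>step_law x n)
        \<le> ennreal (stuck_weight c r m \<mu> n x)" if "x n \<notin> interior (hull_upto x n)" for n x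
      by (rule stuck_weight_step[OF that _ _ q_def c(2) r(1,3)]) (use \<mu> in auto)
    show "stuck_weight c r m \<mu> 0 x \<le> 2" for x
    proof -
      have "return_sum (far_count m) \<mu> 0 x \<le> real m"
        using far_count_sum_le[of m x 0] by (simp add: return_sum_def)
      then have "r * return_sum (far_count m) \<mu> 0 x \<le> r * real m" using r0 by (rule mult_left_mono)
      then show ?thesis using r(4) by (simp add: stuck_weight_def mult.commute)
    qed
  qed
  have E2: "(\<integral>\<^sup>+\<omega>. ennreal (width_weight l \<delta> m \<mu> n (hist X n \<omega>)) \<partial>M) \<le> ennreal 1" for n
  proof (rule expectation_supermartingale_le[OF walk measurable_width_weight])
    show "(\<integral>\<^sup>+\<theta>. ennreal (width_weight l \<delta> m \<mu> (Suc n) (x(Suc n := x n + cis \<theta>))) \<partial>step_law x n)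
        \<le> ennreal (width_weight l \<delta> m \<mu> n x)" if "x n \<notin> interior (hull_upto x n)" for n x
      by (rule width_weight_step[OF that m \<delta>_def \<mu>_def _ lm]) (use m0 in auto)
    show "width_weight l \<delta> m \<mu> 0 x \<le> 1" if "x 0 = 0" for x
      using that by (simp add: width_weight_def pen_sum_def)
  qed
  have measU: "return_sum a (c1 / 4) n \<in> borel_measurable (PiM {..n} (\<lambda>_. borel))" for n
    by (rule measurable_return_sum) (auto simp: a_def)
  have E3: "(\<integral>\<^sup>+\<omega>. ennreal (return_sum a (c1 / 4) n (hist X n \<omega>)) \<partial>M) \<le> ennreal K" for n
    unfolding K_def
  proof (rule expectation_return_sum_le[OF walk _ _ _ _ _ measU])
    have "(\<Sum>i\<le>s. of_bool (i = 0) :: real) = 1" for s :: nat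
      by (induction s) auto
    then show "(\<Sum>i\<le>s. a x s i) \<le> 1" for x s by (simp add: a_def)
  qed (use m0 in \<open>auto simp: a_def\<close>)
  define b where "b = min (c / 8) (min (l / 192) (c1\<^sup>2 / 8))"
  have b: "0 < b" "b \<le> c / 8" "b \<le> l / 192" "b \<le> c1\<^sup>2 / 8" using c(1) m0 by (auto simp: b_def)
  show thesis
  proof (rule that[of c1 "2 + 1 + K" b])
    fix n
    define S1 where "S1 = {\<omega> \<in> space M. exp (c / 8 * real n) \<le> stuck_weight c r m \<mu> n (hist X n \<omega>)}"
    define S2 where "S2 = {\<omega> \<in> space M. exp (l / 192 * real n) \<le> width_weight l \<delta> m \<mu> n (hist X n \<omega>)}"
    define S3 where "S3 = {\<omega> \<in> space M. exp (c1\<^sup>2 / 8 * real n) \<le> return_sum a (c1 / 4) n (hist X n \<omega>)}"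
    note meas1 [measurable] = measurable_compose[OF hist_meas measurable_stuck_weight[of c r m \<mu> n]]
    note meas2 [measurable] = measurable_compose[OF hist_meas measurable_width_weight[of l \<delta> m \<mu> n]]
    note meas3 [measurable] = measurable_compose[OF hist_meas measU[of n]]
    have [measurable]: "S1 \<in> sets M" "S2 \<in> sets M" "S3 \<in> sets M" unfolding S1_def S2_def S3_def by measurable
    have decay: "exp (- (t * real n)) \<le> exp (- b * real n)" if "b \<le> t" for t
      using mult_right_mono[OF that, of "real n"] by simp
    have "prob S1 \<le> 2 * exp (- (c / 8 * real n))"
      unfolding S1_def by (rule prob_exp_le[OF meas1 E1]) simp
    also have "\<dots> \<le> 2 * exp (- b * real n)" using decay[OF b(2)] by (intro mult_left_mono) auto
    finally have 1: "prob S1 \<le> 2 * exp (- b * real n)" .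
    have "prob S2 \<le> 1 * exp (- (l / 192 * real n))"
      unfolding S2_def by (rule prob_exp_le[OF meas2 E2]) simp
    also have "\<dots> \<le> 1 * exp (- b * real n)" using decay[OF b(3)] by (intro mult_left_mono) auto
    finally have 2: "prob S2 \<le> 1 * exp (- b * real n)" .
    have "prob S3 \<le> K * exp (- (c1\<^sup>2 / 8 * real n))"
      unfolding S3_def by (rule prob_exp_le[OF meas3 E3]) (use K in simp)
    also have "\<dots> \<le> K * exp (- b * real n)" using decay[OF b(4)] K by (intro mult_left_mono) auto
    finally have 3: "prob S3 \<le> K * exp (- b * real n)" .
    have "{\<omega> \<in> space M. norm (X n \<omega>) \<le> c1 * real n} \<subseteq> S1 \<union> S2 \<union> S3"
    proof
      fix \<omega> assume \<omega>: "\<omega> \<in> {\<omega> \<in> space M. norm (X n \<omega>) \<le> c1 * real n}"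
      have x0: "hist X n \<omega> 0 = 0" using walk \<omega> by (simp add: is_hull_avoiding_walk_def)
      have close: "norm (hist X n \<omega> n) \<le> c1 * real n" using \<omega> by simp
      show "\<omega> \<in> S1 \<union> S2 \<union> S3"
        using walk_displacement_cases[OF m0(1,2) r0 r(2) x0 l_def c1_def close, of \<mu>] \<omega>
        by (auto simp: S1_def S2_def S3_def a_def)
    qed
    then have "prob {\<omega> \<in> space M. norm (X n \<omega>) \<le> c1 * real n} \<le> prob (S1 \<union> S2 \<union> S3)"
      by (intro finite_measure_mono) auto
    also have "\<dots> \<le> prob S1 + prob S2 + prob S3"
      using measure_Un_le[of "S1 \<union> S2" M S3] measure_Un_le[of S1 M S2] by simp
    also have "\<dots> \<le> (2 + 1 + K) * exp (- b * real n)" using 1 2 3 by (simp add: distrib_right)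
    finally show "prob {\<omega> \<in> space M. norm (X n \<omega>) \<le> c1 * real n} \<le> (2 + 1 + K) * exp (- b * real n)" .
  qed (use m0 K b in auto)
qed

lemma limsup_ln_ext_exp_decay:
  fixes p :: "nat \<Rightarrow> real"
  assumes "0 < C" "0 < b" "\<And>n. p n \<le> C * exp (- b * real n)"
  shows "limsup (\<lambda>n. ln_ext (p n) / ereal (real n)) < 0"
proof -
  \<comment> \<open>From here on ln C is at most half of b n, so the prefactor costs half of the
    rate.\<close>
  have "eventually (\<lambda>n. real n \<ge> 2 * ln C / b) sequentially"
    using filterlim_real_sequentially by (simp add: filterlim_at_top)
  moreover have "eventually (\<lambda>n::nat. n > 0) sequentially" by (rule eventually_gt_at_top)
  ultimately have "eventually (\<lambda>n. ln_ext (p n) / ereal (real n) \<le> ereal (- b / 2)) sequentially"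
  proof eventually_elim
    case (elim n)
    show ?case
    proof (cases "p n > 0")
      case True
      then have "ln (p n) \<le> ln (C * exp (- b * real n))" using assms by simp
      also have "\<dots> = ln C - b * real n" using assms by (simp add: ln_mult)
      also have "\<dots> \<le> - b / 2 * real n" using elim assms by (simp add: field_simps)
      finally show ?thesis using True elim by (simp add: ln_ext_def divide_le_eq)
    next
      case False
      then show ?thesis using elim by (simp add: ln_ext_def)
    qed
  qed
  then have "limsup (\<lambda>n. ln_ext (p n) / ereal (real n)) \<le> ereal (- b / 2)" by (rule Limsup_bounded)
  also have "\<dots> < 0" using assms by simp
  finally show ?thesis .
qed

theorem theorem1:
  fixes M :: "'a measure" and X :: "nat \<Rightarrow> 'a \<Rightarrow> complex"
  assumes "is_hull_avoiding_walk M X"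
  shows "\<exists>c1 > 0.
           limsup (\<lambda>n. ln_ext (measure M {\<omega> \<in> space M. norm (X n \<omega>) \<le> c1 * real n}) / ereal (real n)) < 0
         \<and> (AE \<omega> in M. liminf (\<lambda>n. ereal (norm (X n \<omega>) / real n)) \<ge> ereal c1)"
proof -
  interpret prob_space M using assms by (simp add: is_hull_avoiding_walk_def)
  have [measurable]: "X k \<in> borel_measurable M" for k using assms by (simp add: is_hull_avoiding_walk_def)
  obtain c1 C b where c: "0 < c1" "0 < C" "0 < b"
    and decay: "\<And>n. prob {\<omega> \<in> space M. norm (X n \<omega>) \<le> c1 * real n} \<le> C * exp (- b * real n)"
    using walk_small_displacement_exp_decay[OF assms] by blast
  let ?A = "\<lambda>n. {\<omega> \<in> space M. norm (X n \<omega>) \<le> c1 * real n}"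
  \<comment> \<open>The exponential bound is summable, so by Borel-Cantelli almost surely only
    finitely many of the events occur, which gives the bound on the lower limit.\<close>
  have "summable (\<lambda>n. C * exp (- b) ^ n)" using c by (intro summable_mult summable_geometric) simp
  then have "summable (\<lambda>n. prob (?A n))"
    by (rule summable_comparison_test') (use decay in \<open>simp add: exp_of_nat_mult[symmetric] mult.commute\<close>)
  then have "AE \<omega> in M. eventually (\<lambda>n. \<omega> \<in> space M - ?A n) sequentially"
    by (intro borel_cantelli_AE1) (auto simp: emeasure_eq_measure)
  then have "AE \<omega> in M. liminf (\<lambda>n. ereal (norm (X n \<omega>) / real n)) \<ge> ereal c1"
  proof eventually_elim
    case (elim \<omega>)
    then have "eventually (\<lambda>n. ereal c1 \<le> ereal (norm (X n \<omega>) / real n)) sequentially"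
      using eventually_gt_at_top[of 0]
      by eventually_elim (auto simp: field_simps)
    then show ?case by (rule Liminf_bounded)
  qed
  then show ?thesis using c limsup_ln_ext_exp_decay[OF c(2,3) decay] by blast
qed

end
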